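(* (Generalized Uniqueness Theorem) Let $\mathscr G$ be an ample groupoid and $\mathcal O$ a $\mathscr G$-sheaf of commutative rings. Let $C$ be the centralizer of $\Gamma_c(\mathscr G^{(0)},\mathcal O)$ in $\Gamma_c(\mathscr G,\mathcal O)$. A ring homomorphism $\pi:\Gamma_c(\mathscr G,\mathcal O)\to A$ (to a ring $A$) is injective if and only if its restriction $\pi|_{C}$ is injective.
   Context: "Compact" includes Hausdorff. Rings (and ring homomorphisms) outside the stalks of the sheaf are not assumed unital. A groupoid $\mathscr G$ (identified with its set of arrows) has unit space $\mathscr G^{(0)}$, $\boldsymbol d(\gamma)=\gamma^{-1}\gamma$, $\boldsymbol r(\gamma)=\gamma\gamma^{-1}$. It is ample if it is a topological groupoid such that $\mathscr G^{(0)}$ is locally compact Hausdorff with a basis of compact open sets and $\boldsymbol r$ is a local homeomorphism ($\mathscr G$ itself need not be Hausdorff). A bisection is a subset on which $\boldsymbol d$ and $\boldsymbol r$ are injective. A $\mathscr G$-sheaf $(E,p,\alpha)$ is a space $E$, a local homeomorphism $p:E\to\mathscr G^{(0)}$ and a continuous map $\alpha:\mathscr G\times_{\boldsymbol d,p}E\to E$, $(\gamma,e)\mapsto\alpha_\gamma(e)$, with $\alpha_{p(e)}(e)=e$, $p(\alpha_\gamma(e))=\boldsymbol r(\gamma)$, and $\alpha_\beta(\alpha_\gamma(e))=\alpha_{\beta\gamma}(e)$ whenever defined. The stalk at $x$ is $p^{-1}(x)$. A $\mathscr G$-sheaf of (commutative) rings $\mathcal O=(E,p,\alpha)$ is a $\mathscr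 G$-sheaf with a unital (commutative) ring structure on each stalk $\mathcal O_x$ such that fiberwise addition and multiplication $E\times_{p,p}E\to E$ and the unit section $x\mapsto 1_x$ are continuous, and each $\alpha_\gamma:\mathcal O_{\boldsymbol d(\gamma)}\to\mathcal O_{\boldsymbol r(\gamma)}$ is a (unital) ring homomorphism. $\Gamma_c(\mathscr G,\mathcal O)$ is the additive group generated by all maps $f:\mathscr G\to E$ with $p\circ f=\boldsymbol r$ for which there is a compact open bisection $U$ with $f|_U$ continuous and $f=0$ off $U$. It is a ring under pointwise addition and convolution $(f*g)(\gamma)=\sum_{\beta\rho=\gamma}f(\beta)\alpha_\beta(g(\rho))$. $\Gamma_c(\mathscr G^{(0)},\mathcal O)$ is the ring of compactly supported continuous sections $\mathscr G^{(0)}\to E$ of $p$ with pointwise operations, viewed as a subring of $\Gamma_c(\mathscr G,\mathcal O)$ by extending by zero. *)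

theory Defs
  imports "HOL-Analysis.Analysis" "HOL-Algebra.QuotRing" "HOL-Algebra.Generated_Groups"
begin

section \<open>Rings without unit\<close>

text \<open>The \<open>one\<close> component of the underlying record is ignored.\<close>

locale nonunital_ring = abelian_group R for R (structure) +
  assumes m_closed: "\<lbrakk>x \<in> carrier R; y \<in> carrier R\<rbrakk> \<Longrightarrow> x \<otimes> y \<in> carrier R"
    and m_assoc: "\<lbrakk>x \<in> carrier R; y \<in> carrier R; z \<in> carrier R\<rbrakk>
      \<Longrightarrow> (x \<otimes> y) \<otimes> z = x \<otimes> (y \<otimes> z)"
    and l_distr: "\<lbrakk>x \<in> carrier R; y \<in> carrier R; z \<in> carrier R\<rbrakk>
      \<Longrightarrow> (x \<oplus> y) \<otimes> z = x \<otimes> z \<oplus> y \<otimes> z"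
    and r_distr: "\<lbrakk>x \<in> carrier R; y \<in> carrier R; z \<in> carrier R\<rbrakk>
      \<Longrightarrow> z \<otimes> (x \<oplus> y) = z \<otimes> x \<oplus> z \<otimes> y"

definition nonunital_ring_hom ::
    "('a, 'm) ring_scheme \<Rightarrow> ('b, 'n) ring_scheme \<Rightarrow> ('a \<Rightarrow> 'b) set" where
  "nonunital_ring_hom R S = hom R S \<inter> hom (add_monoid R) (add_monoid S)"

definition centralizer_in :: "('a, 'm) ring_scheme \<Rightarrow> 'a set \<Rightarrow> 'a set" where
  "centralizer_in R D = {c \<in> carrier R. \<forall>d\<in>D. c \<otimes>\<^bsub>R\<^esub> d = d \<otimes>\<^bsub>R\<^esub> c}"


section \<open>Ample groupoids\<close>

definition local_homeomorphism :: "'a topology \<Rightarrow> 'b topology \<Rightarrow> ('a \<Rightarrow> 'b) \<Rightarrow> bool" where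
  "local_homeomorphism X Y f \<longleftrightarrow>
    (\<forall>x\<in>topspace X. \<exists>U. openin X U \<and> x \<in> U \<and> openin Y (f ` U) \<and>
      homeomorphic_map (subtopology X U) (subtopology Y (f ` U)) f)"

text \<open>
  A groupoid is identified with its set of arrows, which is the underlying set of the topology
  \<open>gtop\<close>. The partial product \<open>gmult\<close> is represented by a total function whose values are
  meaningful only on composable pairs.
\<close>

record 'g groupoid =
  gtop :: "'g topology"
  gmult :: "'g \<Rightarrow> 'g \<Rightarrow> 'g"
  ginv :: "'g \<Rightarrow> 'g"

definition arrows :: "'g groupoid \<Rightarrow> 'g set" where
  "arrows G = topspace (gtop G)"

definition src :: "'g groupoid \<Rightarrow> 'g \<Rightarrow> 'g" where
  "src G \<gamma> = gmult G (ginv G \<gamma>) \<gamma>"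

definition rng :: "'g groupoid \<Rightarrow> 'g \<Rightarrow> 'g" where
  "rng G \<gamma> = gmult G \<gamma> (ginv G \<gamma>)"

definition units :: "'g groupoid \<Rightarrow> 'g set" where
  "units G = src G ` arrows G"

definition unit_top :: "'g groupoid \<Rightarrow> 'g topology" where
  "unit_top G = subtopology (gtop G) (units G)"

definition composable :: "'g groupoid \<Rightarrow> 'g \<Rightarrow> 'g \<Rightarrow> bool" where
  "composable G \<beta> \<gamma> \<longleftrightarrow> \<beta> \<in> arrows G \<and> \<gamma> \<in> arrows G \<and> src G \<beta> = rng G \<gamma>"

text \<open>
  The axioms of a small category all of whose arrows are invertible; that \<open>ginv G \<gamma>\<close> is a
  two-sided inverse of \<open>\<gamma>\<close> is built into the definitions of \<open>src\<close> and \<open>rng\<close>.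
\<close>

locale groupoid =
  fixes G :: "'g groupoid"
  assumes inv_closed: "\<gamma> \<in> arrows G \<Longrightarrow> ginv G \<gamma> \<in> arrows G"
    and src_inv: "\<gamma> \<in> arrows G \<Longrightarrow> src G (ginv G \<gamma>) = rng G \<gamma>"
    and rng_inv: "\<gamma> \<in> arrows G \<Longrightarrow> rng G (ginv G \<gamma>) = src G \<gamma>"
    and mult_closed: "composable G \<beta> \<gamma> \<Longrightarrow> gmult G \<beta> \<gamma> \<in> arrows G"
    and src_mult: "composable G \<beta> \<gamma> \<Longrightarrow> src G (gmult G \<beta> \<gamma>) = src G \<gamma>"
    and rng_mult: "composable G \<beta> \<gamma> \<Longrightarrow> rng G (gmult G \<beta> \<gamma>) = rng G \<beta>"
    and mult_assoc: "\<lbrakk>composable G \<alpha> \<beta>; composable G \<beta> \<gamma>\<rbrakk>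
      \<Longrightarrow> gmult G (gmult G \<alpha> \<beta>) \<gamma> = gmult G \<alpha> (gmult G \<beta> \<gamma>)"
    and mult_src: "\<gamma> \<in> arrows G \<Longrightarrow> gmult G \<gamma> (src G \<gamma>) = \<gamma>"
    and rng_mult_left: "\<gamma> \<in> arrows G \<Longrightarrow> gmult G (rng G \<gamma>) \<gamma> = \<gamma>"

locale topological_groupoid = groupoid +
  assumes continuous_mult:
      "continuous_map
        (subtopology (prod_topology (gtop G) (gtop G)) {(\<beta>, \<gamma>). composable G \<beta> \<gamma>})
        (gtop G) (\<lambda>(\<beta>, \<gamma>). gmult G \<beta> \<gamma>)"
    and continuous_inv: "continuous_map (gtop G) (gtop G) (ginv G)"

locale ample_groupoid = topological_groupoid +
  assumes units_locally_compact: "locally_compact_space (unit_top G)"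
    and units_Hausdorff: "Hausdorff_space (unit_top G)"
    and units_basis: "\<lbrakk>openin (unit_top G) V; x \<in> V\<rbrakk>
      \<Longrightarrow> \<exists>K. openin (unit_top G) K \<and> compactin (unit_top G) K \<and> x \<in> K \<and> K \<subseteq> V"
    and rng_local_homeomorphism: "local_homeomorphism (gtop G) (unit_top G) (rng G)"

text \<open>
  The topology on the arrows need not be Hausdorff; compactness of a subset includes the
  Hausdorff property of its subspace topology.
\<close>

definition compact_open_bisection :: "'g groupoid \<Rightarrow> 'g set \<Rightarrow> bool" where
  "compact_open_bisection G U \<longleftrightarrow>
    openin (gtop G) U \<and> compactin (gtop G) U \<and> Hausdorff_space (subtopology (gtop G) U) \<and>
    inj_on (src G) U \<and> inj_on (rng G) U"


section \<open>Sheaves of rings on a groupoid\<close>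

record ('g, 'e) gsheaf =
  etop :: "'e topology"
  proj :: "'e \<Rightarrow> 'g"
  act :: "'g \<Rightarrow> 'e \<Rightarrow> 'e"

text \<open>
  The ring operations of all the stalks are bundled into the fiberwise operations \<open>eadd\<close> and
  \<open>emult\<close>, whose values are meaningful only on pairs of elements in the same stalk, and into the
  zero and unit sections \<open>ezero\<close> and \<open>eone\<close>.
\<close>

record ('g, 'e) ring_gsheaf = "('g, 'e) gsheaf" +
  eadd :: "'e \<Rightarrow> 'e \<Rightarrow> 'e"
  emult :: "'e \<Rightarrow> 'e \<Rightarrow> 'e"
  ezero :: "'g \<Rightarrow> 'e"
  eone :: "'g \<Rightarrow> 'e"

definition stalk :: "('g, 'e) ring_gsheaf \<Rightarrow> 'g \<Rightarrow> 'e ring" where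
  "stalk \<O> x =
    \<lparr>carrier = {e \<in> topspace (etop \<O>). proj \<O> e = x},
     mult = emult \<O>, one = eone \<O> x, zero = ezero \<O> x, add = eadd \<O>\<rparr>"

locale groupoid_sheaf =
  fixes G :: "'g groupoid" and E :: "('g, 'e, 'm) gsheaf_scheme"
  assumes proj_local_homeomorphism: "local_homeomorphism (etop E) (unit_top G) (proj E)"
    and continuous_act:
      "continuous_map
        (subtopology (prod_topology (gtop G) (etop E)) {(\<gamma>, e). src G \<gamma> = proj E e})
        (etop E) (\<lambda>(\<gamma>, e). act E \<gamma> e)"
    and act_unit: "e \<in> topspace (etop E) \<Longrightarrow> act E (proj E e) e = e"
    and proj_act: "\<lbrakk>\<gamma> \<in> arrows G; e \<in> topspace (etop E); src G \<gamma> = proj E e\<rbrakk>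
      \<Longrightarrow> proj E (act E \<gamma> e) = rng G \<gamma>"
    and act_act: "\<lbrakk>composable G \<beta> \<gamma>; e \<in> topspace (etop E); src G \<gamma> = proj E e\<rbrakk>
      \<Longrightarrow> act E \<beta> (act E \<gamma> e) = act E (gmult G \<beta> \<gamma>) e"

locale groupoid_sheaf_of_rings = groupoid_sheaf G \<O>
  for G :: "'g groupoid" and \<O> :: "('g, 'e) ring_gsheaf" +
  assumes stalk_ring: "x \<in> units G \<Longrightarrow> ring (stalk \<O> x)"
    and continuous_add:
      "continuous_map
        (subtopology (prod_topology (etop \<O>) (etop \<O>)) {(a, b). proj \<O> a = proj \<O> b})
        (etop \<O>) (\<lambda>(a, b). eadd \<O> a b)"
    and continuous_emult:
      "continuous_map
        (subtopology (prod_topology (etop \<O>) (etop \<O>)) {(a, b). proj \<O> a = proj \<O> b})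
        (etop \<O>) (\<lambda>(a, b). emult \<O> a b)"
    and continuous_one: "continuous_map (unit_top G) (etop \<O>) (eone \<O>)"
    and act_ring_hom: "\<gamma> \<in> arrows G
      \<Longrightarrow> act \<O> \<gamma> \<in> ring_hom (stalk \<O> (src G \<gamma>)) (stalk \<O> (rng G \<gamma>))"

locale groupoid_sheaf_of_comm_rings = groupoid_sheaf_of_rings +
  assumes stalk_cring: "x \<in> units G \<Longrightarrow> cring (stalk \<O> x)"


section \<open>The convolution ring\<close>

text \<open>
  Maps defined on the set of arrows (or of units) are represented by functions that are
  \<^term>\<open>undefined\<close> elsewhere, so that equality of functions is equality of maps.
  The following is the additive group of all maps \<open>f\<close> from the arrows to the total space
  with \<open>p \<circ> f = r\<close>, without any continuity condition.
\<close>

definition section_group :: "'g groupoid \<Rightarrow> ('g, 'e) ring_gsheaf \<Rightarrow> ('g \<Rightarrow> 'e) monoid" where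
  "section_group G \<O> =
    \<lparr>carrier = (\<Pi>\<^sub>E \<gamma>\<in>arrows G. carrier (stalk \<O> (rng G \<gamma>))),
     mult = (\<lambda>f g. \<lambda>\<gamma>\<in>arrows G. eadd \<O> (f \<gamma>) (g \<gamma>)),
     one = (\<lambda>\<gamma>\<in>arrows G. ezero \<O> (rng G \<gamma>))\<rparr>"

definition gamma_c_generators :: "'g groupoid \<Rightarrow> ('g, 'e) ring_gsheaf \<Rightarrow> ('g \<Rightarrow> 'e) set" where
  "gamma_c_generators G \<O> =
    {f \<in> carrier (section_group G \<O>). \<exists>U. compact_open_bisection G U \<and>
      continuous_map (subtopology (gtop G) U) (etop \<O>) f \<and>
      (\<forall>\<gamma>\<in>arrows G - U. f \<gamma> = ezero \<O> (rng G \<gamma>))}"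

text \<open>
  The convolution sum at \<open>\<gamma>\<close> is taken in the stalk at \<open>rng G \<gamma>\<close>. The index set is restricted to the
  nonzero terms, because \<^term>\<open>finsum\<close> returns zero on infinite index sets.
\<close>

definition convolution ::
    "'g groupoid \<Rightarrow> ('g, 'e) ring_gsheaf \<Rightarrow> ('g \<Rightarrow> 'e) \<Rightarrow> ('g \<Rightarrow> 'e) \<Rightarrow> 'g \<Rightarrow> 'e" where
  "convolution G \<O> f g = (\<lambda>\<gamma>\<in>arrows G.
    finsum (stalk \<O> (rng G \<gamma>)) (\<lambda>(\<beta>, \<rho>). emult \<O> (f \<beta>) (act \<O> \<beta> (g \<rho>)))
      {(\<beta>, \<rho>). composable G \<beta> \<rho> \<and> gmult G \<beta> \<rho> = \<gamma> \<and>
        emult \<O> (f \<beta>) (act \<O> \<beta> (g \<rho>)) \<noteq> ezero \<O> (rng G \<gamma>)})"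

text \<open>The ring \<open>gamma_c\<close> is not unital in general, so that its \<open>one\<close> component is arbitrary.\<close>

definition gamma_c :: "'g groupoid \<Rightarrow> ('g, 'e) ring_gsheaf \<Rightarrow> ('g \<Rightarrow> 'e) ring" where
  "gamma_c G \<O> =
    \<lparr>carrier = generate (section_group G \<O>) (gamma_c_generators G \<O>),
     mult = convolution G \<O>,
     one = undefined,
     zero = \<one>\<^bsub>section_group G \<O>\<^esub>,
     add = (\<otimes>\<^bsub>section_group G \<O>\<^esub>)\<rparr>"

definition compact_sections :: "'g groupoid \<Rightarrow> ('g, 'e) ring_gsheaf \<Rightarrow> ('g \<Rightarrow> 'e) set" where
  "compact_sections G \<O> =
    {s \<in> extensional (units G). continuous_map (unit_top G) (etop \<O>) s \<and>
      (\<forall>x\<in>units G. proj \<O> (s x) = x) \<and>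
      compactin (unit_top G) (unit_top G closure_of {x \<in> units G. s x \<noteq> ezero \<O> x})}"

definition extend_by_zero ::
    "'g groupoid \<Rightarrow> ('g, 'e) ring_gsheaf \<Rightarrow> ('g \<Rightarrow> 'e) \<Rightarrow> 'g \<Rightarrow> 'e" where
  "extend_by_zero G \<O> s =
    (\<lambda>\<gamma>\<in>arrows G. if \<gamma> \<in> units G then s \<gamma> else ezero \<O> (rng G \<gamma>))"

definition gamma_c_units :: "'g groupoid \<Rightarrow> ('g, 'e) ring_gsheaf \<Rightarrow> ('g \<Rightarrow> 'e) set" where
  "gamma_c_units G \<O> = extend_by_zero G \<O> ` compact_sections G \<O>"

end

(*
  Suppose f is a nonzero element of the kernel of pi which is a sum of n generators, with n as small
  as possible over all nonzero kernel elements. If f does not vanish at an arrow in the bisection U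
  supporting one of the terms, then convolving f on the right with the indicator of the inverse of U
  gives a nonzero kernel element h, again with n terms, one of which is now supported on units. For
  a section a over the units, the commutator of h and a is computed termwise, by multiplying pointwise
  by the section that sends an arrow g to (g . a(d g)) - a(r g). As the stalks are commutative, this kills the
  term supported on units, so the commutator lies in the kernel and has n - 1 terms, hence is zero
  by minimality. So h is a nonzero element of the centralizer in the kernel.
*)
theory Submission
  imports Defs
begin

section \<open>Local homeomorphisms\<close>

text \<open>The arrow space need not be Hausdorff. A sum of generators is then in general not
  continuous, and the units need not be closed among the arrows, so truncating an element to the
  units may leave the ring. Even where it does not, it may leave the kernel. The proof therefore
  uses only two operations, both of which act on each term separately and send generators to
  generators: right translation by a compact open bisection, and pointwise multiplication by a
  continuous section defined on all arrows. Neither raises the number of terms. The commutator with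
  a section over the units is of the second kind and takes the place of a truncation, since its
  coefficient is continuous everywhere and vanishes at every unit.

  Translation keeps the element nonzero because its value at \<open>r(\<gamma>)\<close> is the old
  value at \<open>\<gamma>\<close>; the term that supplies \<open>U\<close> is therefore chosen to
  be nonzero at \<open>\<gamma>\<close>. Convolution is evaluated only when one factor is the
  indicator of a bisection or a section over the units, and then the sum at an arrow has at most one
  nonzero term.\<close>

lemma local_homeomorphism_nbhd:
  assumes "local_homeomorphism X Y f" "x \<in> topspace X"
  obtains U where "openin X U" "x \<in> U" "openin Y (f ` U)" "inj_on f U"
    "homeomorphic_map (subtopology X U) (subtopology Y (f ` U)) f"
proof -
  obtain U where U: "openin X U" "x \<in> U" "openin Y (f ` U)"
    "homeomorphic_map (subtopology X U) (subtopology Y (f ` U)) f"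
    using assms unfolding local_homeomorphism_def by blast
  have "inj_on f U"
    using U homeomorphic_imp_injective_map[OF U(4)] openin_subset[OF U(1)]
    by (simp add: Int_absorb1 topspace_subtopology)
  with U that show thesis by blast
qed

text \<open>Continuity is local on the domain. The witness \<open>g\<close> need agree with
  \<open>f\<close> only on \<open>W\<close>, so a map without a convenient global formula can be
  replaced near each point by a local section of the sheaf.\<close>

lemma continuous_map_locally:
  assumes "\<And>x. x \<in> topspace X \<Longrightarrow>
    \<exists>W g. openin X W \<and> x \<in> W \<and> continuous_map (subtopology X W) Y g \<and> (\<forall>y\<in>W. f y = g y)"
  shows "continuous_map X Y f"
proof -
  have "\<exists>W. openin X W \<and> x \<in> W \<and> continuous_map (subtopology X W) Y f" if x: "x \<in> topspace X" for x
  proof -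
    obtain W g where W: "openin X W" "x \<in> W" "continuous_map (subtopology X W) Y g"
        "\<forall>y\<in>W. f y = g y"
      using assms[OF x] by blast
    then have "continuous_map (subtopology X W) Y f"
      by (auto intro: continuous_map_eq[OF W(3)])
    with W show ?thesis by blast
  qed
  then obtain W where W: "\<And>x. x \<in> topspace X \<Longrightarrow> openin X (W x) \<and> x \<in> W x \<and> continuous_map (subtopology X (W x)) Y f"
    by metis
  show ?thesis
    unfolding continuous_map
  proof (intro conjI allI impI)
    show "f ` topspace X \<subseteq> topspace Y"
    proof clarify
      fix x assume x: "x \<in> topspace X"
      then have "f \<in> topspace (subtopology X (W x)) \<rightarrow> topspace Y"
        using W continuous_map_funspace by blast
      then show "f x \<in> topspace Y" using W[OF x] x by auto
    qed
    fix U assume U: "openin Y U"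
    show "openin X {x \<in> topspace X. f x \<in> U}"
    proof (subst openin_subopen, clarify)
      fix x assume x: "x \<in> topspace X" "f x \<in> U"
      let ?P = "{y \<in> topspace (subtopology X (W x)). f y \<in> U}"
      have "openin (subtopology X (W x)) ?P"
        using W[OF x(1)] U openin_continuous_map_preimage by blast
      then have "openin X ?P" using W[OF x(1)] openin_trans_full by blast
      then show "\<exists>T. openin X T \<and> x \<in> T \<and> T \<subseteq> {x \<in> topspace X. f x \<in> U}"
        using W[OF x(1)] x by (intro exI[of _ ?P]) auto
    qed
  qed
qed

lemma local_homeomorphism_imp_continuous:
  assumes "local_homeomorphism X Y f" shows "continuous_map X Y f"
proof (rule continuous_map_locally)
  fix x assume "x \<in> topspace X"
  then obtain U where U: "openin X U" "x \<in> U"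
      "homeomorphic_map (subtopology X U) (subtopology Y (f ` U)) f"
    using local_homeomorphism_nbhd[OF assms] by metis
  then have "continuous_map (subtopology X U) Y f"
    using homeomorphic_imp_continuous_map continuous_map_in_subtopology by blast
  with U show "\<exists>W g. openin X W \<and> x \<in> W \<and> continuous_map (subtopology X W) Y g \<and> (\<forall>y\<in>W. f y = g y)"
    by blast
qed

lemma local_homeomorphism_imp_open:
  assumes "local_homeomorphism X Y f" shows "open_map X Y f"
  unfolding open_map_def
proof (intro allI impI)
  fix V assume V: "openin X V"
  show "openin Y (f ` V)"
  proof (subst openin_subopen, clarify)
    fix x assume x: "x \<in> V"
    then obtain U where U: "openin X U" "x \<in> U" "openin Y (f ` U)"
        "homeomorphic_map (subtopology X U) (subtopology Y (f ` U)) f"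
      using local_homeomorphism_nbhd[OF assms] V openin_subset by (metis subsetD)
    have "openin (subtopology X U) (V \<inter> U)"
      using V by (simp add: openin_subtopology_Int)
    then have "openin (subtopology Y (f ` U)) (f ` (V \<inter> U))"
      using homeomorphic_imp_open_map[OF U(4)] by (simp add: open_map_def)
    then have "openin Y (f ` (V \<inter> U))" using U(3) openin_trans_full by blast
    then show "\<exists>T. openin Y T \<and> f x \<in> T \<and> T \<subseteq> f ` V" using x U by blast
  qed
qed

text \<open>Under the inverse, the preimage of an open set \<open>U\<close> is the image of
  \<open>V \<inter> U\<close>, which is open because \<open>f\<close> is an open map. This yields
  continuous inverses of \<open>rng\<close> and \<open>src\<close> on bisections and of
  \<open>proj\<close> on small open sets of the sheaf.\<close>

lemma continuous_map_inv_into: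
  assumes "open_map X Y f" "openin X V" "inj_on f V"
  shows "continuous_map (subtopology Y (f ` V)) X (inv_into V f)"
proof -
  have VX: "V \<subseteq> topspace X" using assms(2) openin_subset by blast
  have fV: "openin Y (f ` V)" using assms by (simp add: open_map_def)
  then have fVs: "f ` V \<subseteq> topspace Y" using openin_subset by blast
  show ?thesis
    unfolding continuous_map
  proof (intro conjI allI impI)
    show "inv_into V f ` topspace (subtopology Y (f ` V)) \<subseteq> topspace X"
      using VX by (auto simp: assms(3))
    fix U assume U: "openin X U"
    have "{x \<in> topspace (subtopology Y (f ` V)). inv_into V f x \<in> U} = f ` (V \<inter> U)"
      using assms(3) fVs by (auto simp: inv_into_f_f)
    moreover have "openin Y (f ` (V \<inter> U))"
      using assms(1,2) U by (simp add: open_map_def openin_Int)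
    ultimately show "openin (subtopology Y (f ` V)) {x \<in> topspace (subtopology Y (f ` V)). inv_into V f x \<in> U}"
      using fV by (simp add: openin_open_subtopology image_mono)
  qed
qed

text \<open>Two lifts of the same map that meet at \<open>z\<close> both stay, near
  \<open>z\<close>, inside one open set on which \<open>p\<close> is injective. An equation between
  continuous sections of a sheaf thus spreads from a point to a neighbourhood.\<close>

lemma local_homeomorphism_lifts_agree_near:
  assumes "local_homeomorphism X Y p" "continuous_map Z X a" "continuous_map Z X b"
    and "\<And>z. z \<in> topspace Z \<Longrightarrow> p (a z) = p (b z)"
    and "z \<in> topspace Z" "a z = b z"
  obtains W where "openin Z W" "z \<in> W" "\<And>w. w \<in> W \<Longrightarrow> a w = b w"
proof -
  have "a z \<in> topspace X" using assms(2,5) continuous_map_funspace by blast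
  then obtain U where U: "openin X U" "a z \<in> U" "inj_on p U"
    using local_homeomorphism_nbhd[OF assms(1)] by metis
  let ?W = "{w \<in> topspace Z. a w \<in> U} \<inter> {w \<in> topspace Z. b w \<in> U}"
  have "openin Z ?W"
    using assms(2,3) U(1) openin_continuous_map_preimage openin_Int by blast
  moreover have "z \<in> ?W" using assms(5,6) U(2) by auto
  moreover have "a w = b w" if "w \<in> ?W" for w
    using that U(3) assms(4) by (auto dest: inj_onD)
  ultimately show thesis using that by blast
qed

section \<open>Sums of a given length\<close>

text \<open>Length belongs to a representation and not to the element: repetitions are allowed, and
  one element may occur for several \<open>n\<close>. Only the neutral element has length 0, so
  every other element has only positive lengths.\<close>

primrec sums_of_length :: "('a, 'b) monoid_scheme \<Rightarrow> 'a set \<Rightarrow> nat \<Rightarrow> 'a set" where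
  "sums_of_length M H 0 = {\<one>\<^bsub>M\<^esub>}"
| "sums_of_length M H (Suc n) = {g \<otimes>\<^bsub>M\<^esub> h | g h. g \<in> H \<and> h \<in> sums_of_length M H n}"

lemma (in monoid) sums_of_length_closed:
  assumes "H \<subseteq> carrier G"
  shows "sums_of_length G H n \<subseteq> carrier G"
  using assms by (induction n) auto

lemma (in monoid) sums_of_length_add:
  assumes "H \<subseteq> carrier G" "f \<in> sums_of_length G H m" "g \<in> sums_of_length G H n"
  shows "f \<otimes> g \<in> sums_of_length G H (m + n)"
  using assms(2)
proof (induction m arbitrary: f)
  case 0
  then show ?case using assms(3) sums_of_length_closed[OF assms(1), of n] by (simp add: subset_iff)
next
  case (Suc m)
  then obtain a b where ab: "f = a \<otimes> b" "a \<in> H" "b \<in> sums_of_length G H m" by auto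
  then have "f \<otimes> g = a \<otimes> (b \<otimes> g)"
    using assms sums_of_length_closed[OF assms(1)] m_assoc by blast
  then show ?case using ab Suc.IH by auto
qed

text \<open>If \<open>H\<close> is closed under inverses, the inverse clause of
  \<open>generate\<close> yields nothing beyond \<open>H\<close>. Every member of the generated
  group then has some finite length, which makes a minimal length available.\<close>

lemma (in group) generate_eq_sums_of_length:
  assumes "H \<subseteq> carrier G" "\<And>h. h \<in> H \<Longrightarrow> inv h \<in> H"
  shows "generate G H = (\<Union>n. sums_of_length G H n)"
proof
  have gen: "h \<in> sums_of_length G H (Suc 0)" if "h \<in> H" for h
  proof -
    have "h = h \<otimes> \<one>" using that assms(1) by auto
    then show ?thesis using that by auto
  qed
  show "generate G H \<subseteq> (\<Union>n. sums_of_length G H n)"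
  proof
    fix x assume "x \<in> generate G H"
    then show "x \<in> (\<Union>n. sums_of_length G H n)"
    proof (induction rule: generate.induct)
      case one
      then show ?case by (auto intro!: exI[of _ 0])
    next
      case (incl h)
      then show ?case using gen by blast
    next
      case (inv h)
      then show ?case using gen assms(2) by blast
    next
      case (eng h1 h2)
      then show ?case using sums_of_length_add[OF assms(1)] by blast
    qed
  qed
  have "sums_of_length G H n \<subseteq> generate G H" for n
    by (induction n) (auto intro: generate.one generate.eng generate.incl)
  then show "(\<Union>n. sums_of_length G H n) \<subseteq> generate G H" by blast
qed

section \<open>Ample groupoids\<close>

context groupoid
begin

lemma inv_composable:
  assumes "\<gamma> \<in> arrows G"
  shows "composable G (ginv G \<gamma>) \<gamma>" "composable G \<gamma> (ginv G \<gamma>)"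
  using assms by (auto simp: composable_def inv_closed src_inv rng_inv)

lemma src_arrow: "\<gamma> \<in> arrows G \<Longrightarrow> src G \<gamma> \<in> arrows G"
  using inv_composable mult_closed by (simp add: src_def)

lemma src_src: "\<gamma> \<in> arrows G \<Longrightarrow> src G (src G \<gamma>) = src G \<gamma>"
  using inv_composable(1) src_mult by (metis src_def)

lemma rng_src: "\<gamma> \<in> arrows G \<Longrightarrow> rng G (src G \<gamma>) = src G \<gamma>"
  using inv_composable(1) rng_mult rng_inv by (metis src_def)

lemma src_unit: "x \<in> units G \<Longrightarrow> src G x = x"
  by (auto simp: units_def src_src)

lemma rng_unit: "x \<in> units G \<Longrightarrow> rng G x = x"
  by (auto simp: units_def rng_src)

lemma units_subset: "units G \<subseteq> arrows G"
  by (auto simp: units_def src_arrow)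

lemma unit_arrow: "x \<in> units G \<Longrightarrow> x \<in> arrows G"
  using units_subset by blast

lemma src_in_units: "\<gamma> \<in> arrows G \<Longrightarrow> src G \<gamma> \<in> units G"
  by (auto simp: units_def)

lemma rng_in_units: "\<gamma> \<in> arrows G \<Longrightarrow> rng G \<gamma> \<in> units G"
  using inv_closed src_inv src_in_units by metis

text \<open>The product of \<open>ginv G (ginv G \<gamma>)\<close>, \<open>ginv G \<gamma>\<close>
  and \<open>\<gamma>\<close> is bracketed in both ways: one bracketing gives the double inverse,
  the other gives \<open>\<gamma>\<close>.\<close>

lemma inv_inv:
  assumes "\<gamma> \<in> arrows G" shows "ginv G (ginv G \<gamma>) = \<gamma>"
proof -
  let ?i = "ginv G \<gamma>"
  have i: "?i \<in> arrows G" "ginv G ?i \<in> arrows G" using assms inv_closed by auto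
  have "ginv G ?i = gmult G (ginv G ?i) (src G (ginv G ?i))" using i mult_src by simp
  also have "src G (ginv G ?i) = gmult G ?i \<gamma>"
    using i assms src_inv rng_inv by (simp add: src_def)
  also have "gmult G (ginv G ?i) (gmult G ?i \<gamma>) = gmult G (gmult G (ginv G ?i) ?i) \<gamma>"
    using mult_assoc inv_composable assms i by metis
  also have "\<dots> = gmult G (rng G \<gamma>) \<gamma>"
    using src_inv[OF assms] by (simp add: src_def)
  finally show ?thesis using assms rng_mult_left by simp
qed

lemma mult_inv_cancel:
  assumes "composable G \<beta> \<gamma>" shows "gmult G (gmult G \<beta> \<gamma>) (ginv G \<gamma>) = \<beta>"
proof -
  have "\<gamma> \<in> arrows G" using assms by (simp add: composable_def)
  then have "gmult G (gmult G \<beta> \<gamma>) (ginv G \<gamma>) = gmult G \<beta> (rng G \<gamma>)"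
    using mult_assoc[OF assms] inv_composable by (simp add: rng_def)
  then show ?thesis using assms mult_src by (simp add: composable_def) (metis mult_src)
qed

lemma mult_inv_mult_cancel:
  assumes "\<beta> \<in> arrows G" "\<gamma> \<in> arrows G" "src G \<beta> = src G \<gamma>"
  shows "gmult G (gmult G \<beta> (ginv G \<gamma>)) \<gamma> = \<beta>"
  using mult_inv_cancel[of \<beta> "ginv G \<gamma>"] assms
  by (simp add: composable_def inv_closed rng_inv inv_inv)

end

section \<open>Topology of the arrow space and of the unit space\<close>

context ample_groupoid
begin

lemma topspace_gtop: "topspace (gtop G) = arrows G"
  by (simp add: arrows_def)

lemma topspace_unit_top: "topspace (unit_top G) = units G"
  using units_subset by (auto simp: unit_top_def arrows_def)

lemma continuous_rng: "continuous_map (gtop G) (unit_top G) (rng G)"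
  using rng_local_homeomorphism local_homeomorphism_imp_continuous by blast

lemma continuous_src: "continuous_map (gtop G) (unit_top G) (src G)"
proof (rule continuous_map_eq)
  show "continuous_map (gtop G) (unit_top G) (rng G \<circ> ginv G)"
    using continuous_inv continuous_rng continuous_map_compose by blast
qed (simp add: topspace_gtop rng_inv)

lemma continuous_unit_top_imp:
  "continuous_map X (unit_top G) f \<Longrightarrow> continuous_map X (gtop G) f"
  by (simp add: unit_top_def continuous_map_in_subtopology)

lemma open_rng: "open_map (gtop G) (unit_top G) (rng G)"
  using rng_local_homeomorphism local_homeomorphism_imp_open by blast

lemma openin_inv_image:
  assumes "openin (gtop G) V" shows "openin (gtop G) (ginv G ` V)"
proof -
  have "V \<subseteq> arrows G" using assms openin_subset topspace_gtop by metis
  then have "ginv G ` V = {\<gamma> \<in> topspace (gtop G). ginv G \<gamma> \<in> V}"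
    by (force simp: topspace_gtop inv_closed inv_inv image_iff)
  then show ?thesis
    using openin_continuous_map_preimage[OF continuous_inv assms] by simp
qed

text \<open>Inversion exchanges source and range and preserves open sets, so openness carries over
  from \<open>rng\<close>.\<close>

lemma open_src: "open_map (gtop G) (unit_top G) (src G)"
  unfolding open_map_def
proof (intro allI impI)
  fix V assume V: "openin (gtop G) V"
  then have "V \<subseteq> arrows G" using openin_subset topspace_gtop by metis
  then have "src G ` V = rng G ` ginv G ` V"
    by (auto simp: image_iff rng_inv subset_iff)
  then show "openin (unit_top G) (src G ` V)"
    using openin_inv_image[OF V] open_rng by (simp add: open_map_def)
qed

text \<open>If \<open>U\<close> is an open neighbourhood of a unit on which \<open>rng G\<close> is injective, then \<open>\<gamma> = rng G \<gamma>\<close>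
  whenever both lie in \<open>U\<close>.\<close>

lemma openin_units: "openin (gtop G) (units G)"
proof (subst openin_subopen, clarify)
  fix x assume x: "x \<in> units G"
  then obtain U where U: "openin (gtop G) U" "x \<in> U" "inj_on (rng G) U"
    using local_homeomorphism_nbhd[OF rng_local_homeomorphism] topspace_gtop unit_arrow by metis
  let ?V = "{\<gamma> \<in> topspace (gtop G). rng G \<gamma> \<in> U} \<inter> U"
  have "openin (gtop G) ?V"
    using openin_continuous_map_preimage[OF continuous_unit_top_imp[OF continuous_rng] U(1)] U(1)
    by blast
  moreover have "x \<in> ?V" using x U(2) by (simp add: topspace_gtop unit_arrow rng_unit)
  moreover have "\<gamma> \<in> units G" if "\<gamma> \<in> ?V" for \<gamma>
  proof -
    have "rng G \<gamma> = \<gamma>"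
      using that U(3) rng_unit[OF rng_in_units] by (auto simp: topspace_gtop dest: inj_onD)
    then show ?thesis using that rng_in_units topspace_gtop by force
  qed
  ultimately show "\<exists>T. openin (gtop G) T \<and> x \<in> T \<and> T \<subseteq> units G" by blast
qed

lemma openin_unit_top: "openin (unit_top G) V \<longleftrightarrow> openin (gtop G) V \<and> V \<subseteq> units G"
  by (metis unit_top_def openin_units openin_open_subtopology)

lemma compactin_unit_top: "compactin (unit_top G) K \<longleftrightarrow> compactin (gtop G) K \<and> K \<subseteq> units G"
  by (simp add: unit_top_def compactin_subtopology)

lemma continuous_gmult_compose:
  assumes "continuous_map Z (gtop G) a" "continuous_map Z (gtop G) b"
    and "\<And>z. z \<in> topspace Z \<Longrightarrow> src G (a z) = rng G (b z)"
  shows "continuous_map Z (gtop G) (\<lambda>z. gmult G (a z) (b z))"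
proof -
  have "continuous_map Z (subtopology (prod_topology (gtop G) (gtop G)) {(\<beta>, \<gamma>). composable G \<beta> \<gamma>})
     (\<lambda>z. (a z, b z))"
    unfolding continuous_map_in_subtopology
  proof
    show "continuous_map Z (prod_topology (gtop G) (gtop G)) (\<lambda>z. (a z, b z))"
      using assms(1,2) by (simp add: continuous_map_pairedI)
    have "a z \<in> arrows G" "b z \<in> arrows G" if "z \<in> topspace Z" for z
      using that continuous_map_funspace[OF assms(1)] continuous_map_funspace[OF assms(2)]
      by (auto simp: topspace_gtop Pi_iff)
    then show "(\<lambda>z. (a z, b z)) \<in> topspace Z \<rightarrow> {(\<beta>, \<gamma>). composable G \<beta> \<gamma>}"
      using assms(3) by (simp add: composable_def)
  qed
  from continuous_map_compose[OF this continuous_mult] show ?thesis by (simp add: o_def)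
qed

section \<open>Compact open bisections and right multiplication by a bisection\<close>

lemma compact_open_bisectionI:
  assumes "openin (gtop G) U" "compactin (gtop G) U" "inj_on (src G) U" "inj_on (rng G) U"
  shows "compact_open_bisection G U"
proof -
  \<comment> \<open>The range map injects \<open>U\<close> continuously into the Hausdorff unit
    space, so \<open>U\<close> is Hausdorff even if the arrow space is not.\<close>
  have "Hausdorff_space (subtopology (gtop G) U)"
    using units_Hausdorff
  proof (rule Hausdorff_space_injective_preimage)
    show "continuous_map (subtopology (gtop G) U) (unit_top G) (rng G)"
      using continuous_rng continuous_map_from_subtopology by blast
    show "inj_on (rng G) (topspace (subtopology (gtop G) U))"
      using assms(4) by (auto intro: inj_on_subset)
  qed
  with assms show ?thesis by (simp add: compact_open_bisection_def)
qed

lemma compact_open_bisection_subset: "compact_open_bisection G U \<Longrightarrow> U \<subseteq> arrows G"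
  unfolding compact_open_bisection_def using openin_subset topspace_gtop by metis

lemma compact_open_bisection_inv:
  assumes "compact_open_bisection G V" shows "compact_open_bisection G (ginv G ` V)"
proof (rule compact_open_bisectionI)
  have V: "V \<subseteq> arrows G" using assms compact_open_bisection_subset by simp
  have *: "openin (gtop G) V" "compactin (gtop G) V" "inj_on (src G) V" "inj_on (rng G) V"
    using assms by (simp_all add: compact_open_bisection_def)
  show "openin (gtop G) (ginv G ` V)" by (rule openin_inv_image[OF *(1)])
  show "compactin (gtop G) (ginv G ` V)" by (rule image_compactin[OF *(2) continuous_inv])
  show "inj_on (src G) (ginv G ` V)" "inj_on (rng G) (ginv G ` V)"
    using *(3,4) V by (simp_all add: inj_on_def src_inv rng_inv subset_iff) metis+
qed

text \<open>Right multiplication by the arrow of \<open>V\<close> whose range is the source of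
  \<open>\<gamma>\<close>; that arrow is unique when \<open>rng G\<close> is injective on
  \<open>V\<close>. The value has this meaning only if \<open>src G \<gamma>\<close> lies in the
  image of \<open>V\<close> under \<open>rng G\<close>.\<close>

definition right_shift :: "'a set \<Rightarrow> 'a \<Rightarrow> 'a" where
  "right_shift V \<gamma> = gmult G \<gamma> (inv_into V (rng G) (src G \<gamma>))"

lemma right_shift:
  assumes "V \<subseteq> arrows G" "\<gamma> \<in> arrows G" "src G \<gamma> \<in> rng G ` V"
  shows "inv_into V (rng G) (src G \<gamma>) \<in> V" "rng G (inv_into V (rng G) (src G \<gamma>)) = src G \<gamma>"
    "composable G \<gamma> (inv_into V (rng G) (src G \<gamma>))"
    "right_shift V \<gamma> \<in> arrows G" "rng G (right_shift V \<gamma>) = rng G \<gamma>"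
    "src G (right_shift V \<gamma>) = src G (inv_into V (rng G) (src G \<gamma>))"
    "gmult G (right_shift V \<gamma>) (ginv G (inv_into V (rng G) (src G \<gamma>))) = \<gamma>"
proof -
  let ?v = "inv_into V (rng G) (src G \<gamma>)"
  show v: "?v \<in> V" "rng G ?v = src G \<gamma>"
    using assms(3) by (auto intro: inv_into_into f_inv_into_f)
  then show c: "composable G \<gamma> ?v" using assms by (auto simp: composable_def)
  show "right_shift V \<gamma> \<in> arrows G" "rng G (right_shift V \<gamma>) = rng G \<gamma>"
    "src G (right_shift V \<gamma>) = src G ?v" "gmult G (right_shift V \<gamma>) (ginv G ?v) = \<gamma>"
    using c mult_closed rng_mult src_mult mult_inv_cancel by (auto simp: right_shift_def)
qed

lemma openin_right_shift_domain:
  assumes "openin (gtop G) V"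
  shows "openin (gtop G) {\<gamma> \<in> arrows G. src G \<gamma> \<in> rng G ` V}"
  using openin_continuous_map_preimage[OF continuous_src] open_rng assms
  by (simp add: open_map_def topspace_gtop)

lemma continuous_right_shift:
  assumes "openin (gtop G) V" "inj_on (rng G) V"
  shows "continuous_map (subtopology (gtop G) {\<gamma> \<in> arrows G. src G \<gamma> \<in> rng G ` V})
    (gtop G) (right_shift V)"
  unfolding right_shift_def
proof (rule continuous_gmult_compose)
  let ?D = "{\<gamma> \<in> arrows G. src G \<gamma> \<in> rng G ` V}"
  have V: "V \<subseteq> arrows G" using assms openin_subset topspace_gtop by metis
  show "continuous_map (subtopology (gtop G) ?D) (gtop G) (\<lambda>x. x)"
    by (simp add: continuous_map_from_subtopology)
  have "continuous_map (subtopology (gtop G) ?D) (subtopology (unit_top G) (rng G ` V)) (src G)"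
    using continuous_src by (auto simp: continuous_map_in_subtopology continuous_map_from_subtopology)
  from continuous_map_compose[OF this continuous_map_inv_into[OF open_rng assms]]
  show "continuous_map (subtopology (gtop G) ?D) (gtop G) (\<lambda>x. inv_into V (rng G) (src G x))"
    by (simp add: o_def)
  show "src G z = rng G (inv_into V (rng G) (src G z))" if "z \<in> topspace (subtopology (gtop G) ?D)" for z
    using that right_shift(2)[OF V] by auto
qed

text \<open>The set is the product \<open>U V^{-1}\<close>, since \<open>\<gamma> v = u\<close>
  amounts to \<open>\<gamma> = u v^{-1}\<close>. Openness comes from its form as a preimage of
  \<open>U\<close>, compactness from its form as a continuous image of a part of
  \<open>U\<close>.\<close>

lemma compact_open_bisection_right_shift:
  assumes "compact_open_bisection G U" "compact_open_bisection G V"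
  shows "compact_open_bisection G {\<gamma> \<in> arrows G. src G \<gamma> \<in> rng G ` V \<and> right_shift V \<gamma> \<in> U}"
    (is "compact_open_bisection G ?W")
proof (rule compact_open_bisectionI)
  let ?D = "{\<gamma> \<in> arrows G. src G \<gamma> \<in> rng G ` V}"
  have U: "U \<subseteq> arrows G" "openin (gtop G) U" "compactin (gtop G) U" "inj_on (src G) U" "inj_on (rng G) U"
    using assms(1) compact_open_bisection_subset by (auto simp: compact_open_bisection_def)
  have V: "V \<subseteq> arrows G" "openin (gtop G) V" "compactin (gtop G) V" "inj_on (src G) V" "inj_on (rng G) V"
    using assms(2) compact_open_bisection_subset by (auto simp: compact_open_bisection_def)
  have "openin (subtopology (gtop G) ?D) {\<gamma> \<in> topspace (subtopology (gtop G) ?D). right_shift V \<gamma> \<in> U}"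
    using openin_continuous_map_preimage[OF continuous_right_shift U(2)] V by blast
  moreover have "{\<gamma> \<in> topspace (subtopology (gtop G) ?D). right_shift V \<gamma> \<in> U} = ?W"
    by (auto simp: topspace_gtop)
  ultimately show "openin (gtop G) ?W"
    using openin_trans_full[OF _ openin_right_shift_domain[OF V(2)]] by simp
  \<comment> \<open>\<open>?K\<close> collects the arrows of \<open>U\<close> that share their
    source with an arrow of \<open>V\<close>. It is compact because the source image of
    \<open>V\<close> is compact, hence closed, in the Hausdorff unit space. The map
    \<open>?m\<close> sends \<open>u\<close> to \<open>u v^{-1}\<close> and inverts the
    shift.\<close>
  let ?K = "{u \<in> U. src G u \<in> src G ` V}"
  let ?m = "\<lambda>u. gmult G u (ginv G (inv_into V (src G) (src G u)))"
  have "compactin (unit_top G) (src G ` V)"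
    using image_compactin[OF V(3) continuous_src] .
  then have "closedin (unit_top G) (src G ` V)"
    using compactin_imp_closedin units_Hausdorff by blast
  then have "closedin (gtop G) {\<gamma> \<in> topspace (gtop G). src G \<gamma> \<in> src G ` V}"
    using closedin_continuous_map_preimage continuous_src by blast
  then have "compactin (gtop G) ({\<gamma> \<in> topspace (gtop G). src G \<gamma> \<in> src G ` V} \<inter> U)"
    using closed_Int_compactin U(3) by blast
  moreover have "{\<gamma> \<in> topspace (gtop G). src G \<gamma> \<in> src G ` V} \<inter> U = ?K"
    using U(1) by (auto simp: topspace_gtop)
  ultimately have K: "compactin (gtop G) ?K" by simp
  have "compactin (subtopology (gtop G) ?K) ?K"
    using K by (simp add: compactin_subtopology)
  moreover have "continuous_map (subtopology (gtop G) ?K) (gtop G) ?m"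
  proof (rule continuous_gmult_compose)
    show "continuous_map (subtopology (gtop G) ?K) (gtop G) (\<lambda>x. x)"
      by (simp add: continuous_map_from_subtopology)
    have "continuous_map (subtopology (gtop G) ?K) (subtopology (unit_top G) (src G ` V)) (src G)"
      using continuous_src by (auto simp: continuous_map_in_subtopology continuous_map_from_subtopology)
    from continuous_map_compose[OF continuous_map_compose[OF this
        continuous_map_inv_into[OF open_src V(2,4)]] continuous_inv]
    show "continuous_map (subtopology (gtop G) ?K) (gtop G) (\<lambda>x. ginv G (inv_into V (src G) (src G x)))"
      by (simp add: o_def)
    show "src G z = rng G (ginv G (inv_into V (src G) (src G z)))"
      if "z \<in> topspace (subtopology (gtop G) ?K)" for z
    proof -
      have "src G z \<in> src G ` V" using that by auto
      then show ?thesis using V(1) inv_into_into[of "src G z" "src G" V]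
        by (metis f_inv_into_f rng_inv subsetD)
    qed
  qed
  ultimately have "compactin (gtop G) (?m ` ?K)" by (rule image_compactin)
  moreover have "?m ` ?K = ?W"
  proof (intro equalityI subsetI)
    fix \<gamma> assume "\<gamma> \<in> ?m ` ?K"
    then obtain u where u: "u \<in> U" "src G u \<in> src G ` V" "\<gamma> = ?m u" by blast
    define v where "v = inv_into V (src G) (src G u)"
    have v: "v \<in> V" "src G v = src G u" "\<gamma> = gmult G u (ginv G v)"
      using u inv_into_into[OF u(2)] f_inv_into_f[OF u(2)] by (auto simp: v_def)
    have arr: "u \<in> arrows G" "v \<in> arrows G" using u v U V by auto
    have c: "composable G u (ginv G v)" using arr v by (simp add: composable_def inv_closed rng_inv)
    have \<gamma>: "\<gamma> \<in> arrows G" "src G \<gamma> = rng G v"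
      using mult_closed[OF c] src_mult[OF c] arr v by (auto simp: src_inv)
    moreover have "right_shift V \<gamma> = u"
      unfolding right_shift_def \<gamma>(2) inv_into_f_f[OF V(5) v(1)]
      using mult_inv_mult_cancel[OF arr v(2)[symmetric]] v(3) by simp
    ultimately show "\<gamma> \<in> ?W" using u(1) v(1) by auto
  next
    fix \<gamma> assume \<gamma>: "\<gamma> \<in> ?W"
    define v where "v = inv_into V (rng G) (src G \<gamma>)"
    have r: "v \<in> V" "src G (right_shift V \<gamma>) = src G v" "gmult G (right_shift V \<gamma>) (ginv G v) = \<gamma>"
      using right_shift[OF V(1), of \<gamma>] \<gamma> by (auto simp: v_def)
    then have "?m (right_shift V \<gamma>) = \<gamma>" by (simp add: inv_into_f_f[OF V(4)])
    moreover have "right_shift V \<gamma> \<in> ?K" using \<gamma> r by auto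
    ultimately show "\<gamma> \<in> ?m ` ?K" by (rule image_eqI[OF sym])
  qed
  ultimately show "compactin (gtop G) ?W" by simp
  \<comment> \<open>The shifted arrow has the source of \<open>v\<close>, which determines
    \<open>v\<close> since \<open>src G\<close> is injective on \<open>V\<close>; multiplying by the
    inverse of \<open>v\<close> then returns \<open>\<gamma>\<close>. With the shift injective,
    injectivity of source and range is inherited from \<open>U\<close>.\<close>
  have inj: "\<gamma> = \<gamma>'" if "\<gamma> \<in> ?W" "\<gamma>' \<in> ?W" and eq: "right_shift V \<gamma> = right_shift V \<gamma>'" for \<gamma> \<gamma>'
  proof -
    define v v' where vv': "v = inv_into V (rng G) (src G \<gamma>)" "v' = inv_into V (rng G) (src G \<gamma>')"
    have r: "v \<in> V" "src G (right_shift V \<gamma>) = src G v" "gmult G (right_shift V \<gamma>) (ginv G v) = \<gamma>"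
      using right_shift[OF V(1), of \<gamma>] that(1) by (simp_all add: vv')
    have r': "v' \<in> V" "src G (right_shift V \<gamma>') = src G v'" "gmult G (right_shift V \<gamma>') (ginv G v') = \<gamma>'"
      using right_shift[OF V(1), of \<gamma>'] that(2) by (simp_all add: vv')
    have "v = v'" using inj_onD[OF V(4) _ r(1) r'(1)] r(2) r'(2) eq by simp
    have "\<gamma> = gmult G (right_shift V \<gamma>) (ginv G v)" by (rule r(3)[symmetric])
    also have "\<dots> = gmult G (right_shift V \<gamma>') (ginv G v')" by (simp only: eq \<open>v = v'\<close>)
    finally show ?thesis using r'(3) by (rule trans)
  qed
  show "inj_on (src G) ?W"
  proof (rule inj_onI)
    fix \<gamma> \<gamma>' assume *: "\<gamma> \<in> ?W" "\<gamma>' \<in> ?W" "src G \<gamma> = src G \<gamma>'"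
    then have "src G (right_shift V \<gamma>) = src G (right_shift V \<gamma>')"
      using right_shift(6)[OF V(1), of \<gamma>] right_shift(6)[OF V(1), of \<gamma>'] by simp
    then have "right_shift V \<gamma> = right_shift V \<gamma>'" using inj_onD[OF U(4)] *(1,2) by simp
    then show "\<gamma> = \<gamma>'" by (rule inj[OF *(1,2)])
  qed
  show "inj_on (rng G) ?W"
  proof (rule inj_onI)
    fix \<gamma> \<gamma>' assume *: "\<gamma> \<in> ?W" "\<gamma>' \<in> ?W" "rng G \<gamma> = rng G \<gamma>'"
    then have "rng G (right_shift V \<gamma>) = rng G (right_shift V \<gamma>')"
      using right_shift(5)[OF V(1), of \<gamma>] right_shift(5)[OF V(1), of \<gamma>'] by simp
    then have "right_shift V \<gamma> = right_shift V \<gamma>'" using inj_onD[OF U(5)] *(1,2) by simp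
    then show "\<gamma> = \<gamma>'" by (rule inj[OF *(1,2)])
  qed
qed

end

section \<open>Sheaves of rings\<close>

context nonunital_ring
begin

lemma l_null: assumes "x \<in> carrier R" shows "\<zero> \<otimes> x = \<zero>"
proof -
  have "\<zero> \<otimes> x \<oplus> \<zero> \<otimes> x = \<zero> \<otimes> x"
    using l_distr[of \<zero> \<zero> x] assms by simp
  then show ?thesis using add.l_cancel_one[of "\<zero> \<otimes> x" "\<zero> \<otimes> x"] m_closed assms by simp
qed

lemma r_null: assumes "x \<in> carrier R" shows "x \<otimes> \<zero> = \<zero>"
proof -
  have "x \<otimes> \<zero> \<oplus> x \<otimes> \<zero> = x \<otimes> \<zero>"
    using r_distr[of \<zero> \<zero> x] assms by simp
  then show ?thesis using add.l_cancel_one[of "x \<otimes> \<zero>" "x \<otimes> \<zero>"] m_closed assms by simp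
qed

end

locale ample_groupoid_sheaf = ample_groupoid G + groupoid_sheaf_of_comm_rings G \<O>
  for G :: "'g groupoid" and \<O> :: "('g, 'e) ring_gsheaf"
begin

lemma stalk_simps [simp]:
  "mult (stalk \<O> x) = emult \<O>" "one (stalk \<O> x) = eone \<O> x"
  "zero (stalk \<O> x) = ezero \<O> x" "add (stalk \<O> x) = eadd \<O>"
  by (simp_all add: stalk_def)

lemma carrier_stalk: "e \<in> carrier (stalk \<O> x) \<longleftrightarrow> e \<in> topspace (etop \<O>) \<and> proj \<O> e = x"
  by (simp add: stalk_def)

text \<open>The stalk of \<open>e\<close> is read off from \<open>proj\<close>, so negation becomes
  one map on the whole total space and its continuity can be stated.\<close>

definition eneg :: "'e \<Rightarrow> 'e" where
  "eneg e = a_inv (stalk \<O> (proj \<O> e)) e"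

lemma stalk_closed:
  assumes "x \<in> units G"
  shows zero_closed: "ezero \<O> x \<in> carrier (stalk \<O> x)"
    and one_closed: "eone \<O> x \<in> carrier (stalk \<O> x)"
    and add_closed: "\<lbrakk>a \<in> carrier (stalk \<O> x); b \<in> carrier (stalk \<O> x)\<rbrakk>
      \<Longrightarrow> eadd \<O> a b \<in> carrier (stalk \<O> x)"
    and emult_closed: "\<lbrakk>a \<in> carrier (stalk \<O> x); b \<in> carrier (stalk \<O> x)\<rbrakk>
      \<Longrightarrow> emult \<O> a b \<in> carrier (stalk \<O> x)"
    and neg_closed: "a \<in> carrier (stalk \<O> x) \<Longrightarrow> eneg a \<in> carrier (stalk \<O> x)"
proof -
  interpret S: cring "stalk \<O> x" using stalk_cring assms .
  show "ezero \<O> x \<in> carrier (stalk \<O> x)" "eone \<O> x \<in> carrier (stalk \<O> x)"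
    using S.zero_closed S.one_closed by simp_all
  show "\<lbrakk>a \<in> carrier (stalk \<O> x); b \<in> carrier (stalk \<O> x)\<rbrakk> \<Longrightarrow> eadd \<O> a b \<in> carrier (stalk \<O> x)"
    using S.a_closed[of a b] by simp
  show "\<lbrakk>a \<in> carrier (stalk \<O> x); b \<in> carrier (stalk \<O> x)\<rbrakk> \<Longrightarrow> emult \<O> a b \<in> carrier (stalk \<O> x)"
    using S.m_closed[of a b] by simp
  show "a \<in> carrier (stalk \<O> x) \<Longrightarrow> eneg a \<in> carrier (stalk \<O> x)"
    using S.a_inv_closed[of a] by (simp add: eneg_def carrier_stalk)
qed

text \<open>\<open>add_idem\<close> and \<open>neg_unique\<close> pin down zero and negatives by
  equations; in this form they can be used once such an equation has spread from a point to a
  neighbourhood.\<close>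

lemma stalk_ring_laws:
  assumes "x \<in> units G" "a \<in> carrier (stalk \<O> x)"
  shows add_zero: "eadd \<O> a (ezero \<O> x) = a" "eadd \<O> (ezero \<O> x) a = a"
    and add_neg: "eadd \<O> a (eneg a) = ezero \<O> x" "eadd \<O> (eneg a) a = ezero \<O> x"
    and emult_zero: "emult \<O> a (ezero \<O> x) = ezero \<O> x" "emult \<O> (ezero \<O> x) a = ezero \<O> x"
    and emult_one: "emult \<O> a (eone \<O> x) = a"
    and add_idem: "eadd \<O> a a = a \<Longrightarrow> a = ezero \<O> x"
    and neg_unique: "\<lbrakk>b \<in> carrier (stalk \<O> x); eadd \<O> a b = ezero \<O> x\<rbrakk> \<Longrightarrow> eneg a = b"
    and eadd_comm: "b \<in> carrier (stalk \<O> x) \<Longrightarrow> eadd \<O> a b = eadd \<O> b a"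
    and emult_comm: "b \<in> carrier (stalk \<O> x) \<Longrightarrow> emult \<O> a b = emult \<O> b a"
    and eadd_assoc: "\<lbrakk>b \<in> carrier (stalk \<O> x); c \<in> carrier (stalk \<O> x)\<rbrakk>
      \<Longrightarrow> eadd \<O> (eadd \<O> a b) c = eadd \<O> a (eadd \<O> b c)"
    and emult_add: "\<lbrakk>b \<in> carrier (stalk \<O> x); c \<in> carrier (stalk \<O> x)\<rbrakk>
      \<Longrightarrow> emult \<O> a (eadd \<O> b c) = eadd \<O> (emult \<O> a b) (emult \<O> a c)"
      "\<lbrakk>b \<in> carrier (stalk \<O> x); c \<in> carrier (stalk \<O> x)\<rbrakk>
      \<Longrightarrow> emult \<O> (eadd \<O> b c) a = eadd \<O> (emult \<O> b a) (emult \<O> c a)"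
proof -
  interpret S: cring "stalk \<O> x" using stalk_cring assms(1) .
  have x: "proj \<O> a = x" using assms(2) by (simp add: carrier_stalk)
  show "eadd \<O> a (ezero \<O> x) = a" using S.r_zero[OF assms(2)] by simp
  show "eadd \<O> (ezero \<O> x) a = a" using S.l_zero[OF assms(2)] by simp
  show "eadd \<O> a (eneg a) = ezero \<O> x" using S.r_neg[OF assms(2)] by (simp add: eneg_def x)
  show "eadd \<O> (eneg a) a = ezero \<O> x" using S.l_neg[OF assms(2)] by (simp add: eneg_def x)
  show "emult \<O> a (ezero \<O> x) = ezero \<O> x" using S.r_null[OF assms(2)] by simp
  show "emult \<O> (ezero \<O> x) a = ezero \<O> x" using S.l_null[OF assms(2)] by simp
  show "emult \<O> a (eone \<O> x) = a" using S.r_one[OF assms(2)] by simp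
  show "a = ezero \<O> x" if "eadd \<O> a a = a" using S.add.l_cancel_one[OF assms(2,2)] that by simp
  show "eneg a = b" if "b \<in> carrier (stalk \<O> x)" "eadd \<O> a b = ezero \<O> x"
    using S.minus_equality[of b a] S.a_comm[of a b] that assms(2) by (simp add: eneg_def x)
  show "b \<in> carrier (stalk \<O> x) \<Longrightarrow> eadd \<O> a b = eadd \<O> b a"
    using S.a_comm[of a b] assms(2) by simp
  show "b \<in> carrier (stalk \<O> x) \<Longrightarrow> emult \<O> a b = emult \<O> b a"
    using S.m_comm[of a b] assms(2) by simp
  show "\<lbrakk>b \<in> carrier (stalk \<O> x); c \<in> carrier (stalk \<O> x)\<rbrakk>
      \<Longrightarrow> eadd \<O> (eadd \<O> a b) c = eadd \<O> a (eadd \<O> b c)"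
    using S.a_assoc[of a b c] assms(2) by simp
  show "\<lbrakk>b \<in> carrier (stalk \<O> x); c \<in> carrier (stalk \<O> x)\<rbrakk>
      \<Longrightarrow> emult \<O> a (eadd \<O> b c) = eadd \<O> (emult \<O> a b) (emult \<O> a c)"
    using S.r_distr[of b c a] assms(2) by simp
  show "\<lbrakk>b \<in> carrier (stalk \<O> x); c \<in> carrier (stalk \<O> x)\<rbrakk>
      \<Longrightarrow> emult \<O> (eadd \<O> b c) a = eadd \<O> (emult \<O> b a) (emult \<O> c a)"
    using S.l_distr[of b c a] assms(2) by simp
qed

lemma act_closed:
  assumes "\<gamma> \<in> arrows G" "e \<in> carrier (stalk \<O> (src G \<gamma>))"
  shows "act \<O> \<gamma> e \<in> carrier (stalk \<O> (rng G \<gamma>))"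
  using ring_hom_closed[OF act_ring_hom[OF assms(1)] assms(2)] .

lemma act_one: "\<gamma> \<in> arrows G \<Longrightarrow> act \<O> \<gamma> (eone \<O> (src G \<gamma>)) = eone \<O> (rng G \<gamma>)"
  using ring_hom_one[OF act_ring_hom] by simp

lemma act_zero: "\<gamma> \<in> arrows G \<Longrightarrow> act \<O> \<gamma> (ezero \<O> (src G \<gamma>)) = ezero \<O> (rng G \<gamma>)"
  using ring_hom_zero[OF act_ring_hom] stalk_ring src_in_units rng_in_units by simp

lemma act_unit_arrow: "\<lbrakk>x \<in> units G; e \<in> carrier (stalk \<O> x)\<rbrakk> \<Longrightarrow> act \<O> x e = e"
  using act_unit[of e] by (simp add: carrier_stalk)

lemma continuous_proj: "continuous_map (etop \<O>) (unit_top G) (proj \<O>)"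
  using proj_local_homeomorphism local_homeomorphism_imp_continuous by blast

lemma proj_in_units: "e \<in> topspace (etop \<O>) \<Longrightarrow> proj \<O> e \<in> units G"
  using continuous_map_funspace[OF continuous_proj] by (auto simp: topspace_unit_top)

lemma continuous_eadd_compose:
  assumes "continuous_map Z (etop \<O>) a" "continuous_map Z (etop \<O>) b"
    and "\<And>z. z \<in> topspace Z \<Longrightarrow> proj \<O> (a z) = proj \<O> (b z)"
  shows "continuous_map Z (etop \<O>) (\<lambda>z. eadd \<O> (a z) (b z))"
proof -
  have "continuous_map Z (subtopology (prod_topology (etop \<O>) (etop \<O>)) {(a, b). proj \<O> a = proj \<O> b})
     (\<lambda>z. (a z, b z))"
    using assms by (simp add: continuous_map_in_subtopology continuous_map_pairedI)
  from continuous_map_compose[OF this continuous_add] show ?thesis by (simp add: o_def)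
qed

lemma continuous_emult_compose:
  assumes "continuous_map Z (etop \<O>) a" "continuous_map Z (etop \<O>) b"
    and "\<And>z. z \<in> topspace Z \<Longrightarrow> proj \<O> (a z) = proj \<O> (b z)"
  shows "continuous_map Z (etop \<O>) (\<lambda>z. emult \<O> (a z) (b z))"
proof -
  have "continuous_map Z (subtopology (prod_topology (etop \<O>) (etop \<O>)) {(a, b). proj \<O> a = proj \<O> b})
     (\<lambda>z. (a z, b z))"
    using assms by (simp add: continuous_map_in_subtopology continuous_map_pairedI)
  from continuous_map_compose[OF this continuous_emult] show ?thesis by (simp add: o_def)
qed

lemma continuous_act_compose:
  assumes "continuous_map Z (gtop G) a" "continuous_map Z (etop \<O>) b"
    and "\<And>z. z \<in> topspace Z \<Longrightarrow> src G (a z) = proj \<O> (b z)"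
  shows "continuous_map Z (etop \<O>) (\<lambda>z. act \<O> (a z) (b z))"
proof -
  have "continuous_map Z (subtopology (prod_topology (gtop G) (etop \<O>)) {(\<gamma>, e). src G \<gamma> = proj \<O> e})
     (\<lambda>z. (a z, b z))"
    using assms by (simp add: continuous_map_in_subtopology continuous_map_pairedI)
  from continuous_map_compose[OF this continuous_act] show ?thesis by (simp add: o_def)
qed

text \<open>The section inverts \<open>proj\<close> on a neighbourhood of \<open>e\<close> where
  \<open>proj\<close> is injective. Such sections serve to derive continuity of zero and of
  negation, which is not among the axioms of the sheaf.\<close>

lemma local_section:
  assumes "e \<in> topspace (etop \<O>)"
  obtains D t where "openin (unit_top G) D" "proj \<O> e \<in> D" "t (proj \<O> e) = e"
    "continuous_map (subtopology (unit_top G) D) (etop \<O>) t"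
    "\<And>x. x \<in> D \<Longrightarrow> t x \<in> carrier (stalk \<O> x)"
proof -
  obtain U where U: "openin (etop \<O>) U" "e \<in> U" "openin (unit_top G) (proj \<O> ` U)" "inj_on (proj \<O>) U"
    using local_homeomorphism_nbhd[OF proj_local_homeomorphism assms] by metis
  show thesis
  proof (rule that[of "proj \<O> ` U" "inv_into U (proj \<O>)"])
    show "continuous_map (subtopology (unit_top G) (proj \<O> ` U)) (etop \<O>) (inv_into U (proj \<O>))"
      using continuous_map_inv_into local_homeomorphism_imp_open proj_local_homeomorphism U by blast
    show "inv_into U (proj \<O>) x \<in> carrier (stalk \<O> x)" if "x \<in> proj \<O> ` U" for x
      using that inv_into_into[OF that] f_inv_into_f[OF that] openin_subset[OF U(1)]
      by (auto simp: carrier_stalk)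
  qed (use U in auto)
qed

text \<open>A local section \<open>t\<close> through \<open>0\<^sub>x\<close> agrees at \<open>x\<close> with \<open>t + t\<close>, hence is idempotent near \<open>x\<close>.\<close>

lemma continuous_zero: "continuous_map (unit_top G) (etop \<O>) (ezero \<O>)"
proof (rule continuous_map_locally)
  fix x assume "x \<in> topspace (unit_top G)"
  then have x: "x \<in> units G" by (simp add: topspace_unit_top)
  then have 0: "ezero \<O> x \<in> topspace (etop \<O>)" "proj \<O> (ezero \<O> x) = x"
    using zero_closed carrier_stalk by auto
  obtain D t where D: "openin (unit_top G) D" "x \<in> D" "t x = ezero \<O> x"
    and t: "continuous_map (subtopology (unit_top G) D) (etop \<O>) t"
      "\<And>x. x \<in> D \<Longrightarrow> t x \<in> carrier (stalk \<O> x)"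
    using local_section[OF 0(1)] unfolding 0(2) by metis
  have DU: "D \<subseteq> units G" using D(1) openin_unit_top by blast
  have x2: "x \<in> topspace (subtopology (unit_top G) D)" using D(2) x by (simp add: topspace_unit_top)
  have tt: "continuous_map (subtopology (unit_top G) D) (etop \<O>) (\<lambda>y. eadd \<O> (t y) (t y))"
    using continuous_eadd_compose t(1) by blast
  obtain W where W: "openin (subtopology (unit_top G) D) W" "x \<in> W"
    "\<And>w. w \<in> W \<Longrightarrow> t w = eadd \<O> (t w) (t w)"
  proof (rule local_homeomorphism_lifts_agree_near[OF proj_local_homeomorphism t(1) tt _ x2])
    fix z assume "z \<in> topspace (subtopology (unit_top G) D)"
    then have "z \<in> D" "z \<in> units G" using DU by auto
    then show "proj \<O> (t z) = proj \<O> (eadd \<O> (t z) (t z))"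
      using t(2) add_closed carrier_stalk by metis
  next
    show "t x = eadd \<O> (t x) (t x)" using D(3) add_zero zero_closed x by simp
  qed (rule that)
  have W': "openin (unit_top G) W" "W \<subseteq> D"
    using W(1) D(1) openin_trans_full openin_subset by (blast, fastforce)
  have "ezero \<O> y = t y" if "y \<in> W" for y
  proof -
    have "y \<in> D" "y \<in> units G" using that W'(2) DU by auto
    then show ?thesis using add_idem[OF _ t(2) W(3)[OF that, symmetric]] by simp
  qed
  moreover have "continuous_map (subtopology (unit_top G) W) (etop \<O>) t"
    using t(1) W'(2) by (rule continuous_map_from_subtopology_mono)
  ultimately show "\<exists>W g. openin (unit_top G) W \<and> x \<in> W \<and>
      continuous_map (subtopology (unit_top G) W) (etop \<O>) g \<and> (\<forall>y\<in>W. ezero \<O> y = g y)"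
    using W' W(2) by blast
qed

text \<open>A local section \<open>t\<close> through the negative of \<open>e\<close> is pulled back
  along \<open>proj\<close>. The sum of a point and the value of \<open>t\<close> over its base
  point is zero at \<open>e\<close>, hence near \<open>e\<close>, and there uniqueness of negatives
  identifies \<open>eneg\<close> with the pullback of \<open>t\<close>.\<close>

lemma continuous_eneg: "continuous_map (etop \<O>) (etop \<O>) eneg"
proof (rule continuous_map_locally)
  fix e assume e: "e \<in> topspace (etop \<O>)"
  define x where "x = proj \<O> e"
  have x: "x \<in> units G" "e \<in> carrier (stalk \<O> x)"
    using e proj_in_units by (auto simp: carrier_stalk x_def)
  then have n: "eneg e \<in> topspace (etop \<O>)" "proj \<O> (eneg e) = x"
    using neg_closed carrier_stalk by auto
  obtain D t where D: "openin (unit_top G) D" "x \<in> D" "t x = eneg e"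
    and t: "continuous_map (subtopology (unit_top G) D) (etop \<O>) t"
      "\<And>x. x \<in> D \<Longrightarrow> t x \<in> carrier (stalk \<O> x)"
    using local_section[OF n(1)] unfolding n(2) by metis
  have DU: "D \<subseteq> units G" using D(1) openin_unit_top by blast
  let ?V = "{e \<in> topspace (etop \<O>). proj \<O> e \<in> D}"
  let ?Z = "subtopology (etop \<O>) ?V"
  have V: "openin (etop \<O>) ?V"
    using openin_continuous_map_preimage[OF continuous_proj D(1)] .
  have e2: "e \<in> topspace ?Z" using e D(2) by (simp add: x_def)
  have p: "continuous_map ?Z (subtopology (unit_top G) D) (proj \<O>)"
    using continuous_proj by (auto simp: continuous_map_in_subtopology continuous_map_from_subtopology)
  have tp: "continuous_map ?Z (etop \<O>) (\<lambda>e. t (proj \<O> e))"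
    using continuous_map_compose[OF p t(1)] by (simp add: o_def)
  have tpc: "t (proj \<O> e) \<in> carrier (stalk \<O> (proj \<O> e))" if "e \<in> ?V" for e
    using that t(2) by simp
  have a: "continuous_map ?Z (etop \<O>) (\<lambda>e. eadd \<O> e (t (proj \<O> e)))"
  proof (rule continuous_eadd_compose[OF _ tp])
    show "continuous_map ?Z (etop \<O>) (\<lambda>e. e)" by (simp add: continuous_map_from_subtopology)
    show "proj \<O> z = proj \<O> (t (proj \<O> z))" if "z \<in> topspace ?Z" for z
      using that tpc by (simp add: carrier_stalk)
  qed
  have b: "continuous_map ?Z (etop \<O>) (\<lambda>e. ezero \<O> (proj \<O> e))"
    using continuous_map_compose[OF continuous_map_from_subtopology[OF continuous_proj] continuous_zero]
    by (simp add: o_def)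
  obtain W where W: "openin ?Z W" "e \<in> W"
    "\<And>w. w \<in> W \<Longrightarrow> eadd \<O> w (t (proj \<O> w)) = ezero \<O> (proj \<O> w)"
  proof (rule local_homeomorphism_lifts_agree_near[OF proj_local_homeomorphism a b _ e2])
    fix z assume "z \<in> topspace ?Z"
    then have z: "z \<in> ?V" by simp
    then have "proj \<O> z \<in> units G" "z \<in> carrier (stalk \<O> (proj \<O> z))"
      using DU by (auto simp: carrier_stalk)
    then have "eadd \<O> z (t (proj \<O> z)) \<in> carrier (stalk \<O> (proj \<O> z))"
        "ezero \<O> (proj \<O> z) \<in> carrier (stalk \<O> (proj \<O> z))"
      using add_closed zero_closed tpc[OF z] by auto
    then show "proj \<O> (eadd \<O> z (t (proj \<O> z))) = proj \<O> (ezero \<O> (proj \<O> z))"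
      by (simp add: carrier_stalk)
  next
    show "eadd \<O> e (t (proj \<O> e)) = ezero \<O> (proj \<O> e)"
      using add_neg(1)[OF x] D(3) by (simp add: x_def)
  qed (rule that)
  have W': "openin (etop \<O>) W" "W \<subseteq> ?V"
    using W(1) V openin_trans_full openin_subset by (blast, fastforce)
  have "eneg y = t (proj \<O> y)" if "y \<in> W" for y
  proof -
    have "y \<in> ?V" using that W'(2) by blast
    then show ?thesis
      using neg_unique[of "proj \<O> y" y, OF _ _ tpc W(3)[OF that]] DU by (auto simp: carrier_stalk)
  qed
  moreover have "continuous_map (subtopology (etop \<O>) W) (etop \<O>) (\<lambda>e. t (proj \<O> e))"
    using tp W'(2) by (rule continuous_map_from_subtopology_mono)
  ultimately show "\<exists>W g. openin (etop \<O>) W \<and> e \<in> W \<and>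
      continuous_map (subtopology (etop \<O>) W) (etop \<O>) g \<and> (\<forall>y\<in>W. eneg y = g y)"
    using W' W(2) by blast
qed

section \<open>The group of sections and the lengths of its elements\<close>

lemma carrier_section_group:
  "f \<in> carrier (section_group G \<O>) \<longleftrightarrow>
    f \<in> extensional (arrows G) \<and> (\<forall>\<gamma>\<in>arrows G. f \<gamma> \<in> carrier (stalk \<O> (rng G \<gamma>)))"
  by (auto simp: section_group_def PiE_iff)

lemma section_group_mult:
  "f \<otimes>\<^bsub>section_group G \<O>\<^esub> g = (\<lambda>\<gamma>\<in>arrows G. eadd \<O> (f \<gamma>) (g \<gamma>))"
  by (simp add: section_group_def)

lemma section_group_one: "\<one>\<^bsub>section_group G \<O>\<^esub> = (\<lambda>\<gamma>\<in>arrows G. ezero \<O> (rng G \<gamma>))"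
  by (simp add: section_group_def)

lemma section_stalk:
  "\<lbrakk>f \<in> carrier (section_group G \<O>); \<gamma> \<in> arrows G\<rbrakk> \<Longrightarrow> f \<gamma> \<in> carrier (stalk \<O> (rng G \<gamma>))"
  by (simp add: carrier_section_group)

lemma section_eqI:
  assumes "f \<in> carrier (section_group G \<O>)" "g \<in> carrier (section_group G \<O>)"
    "\<And>\<gamma>. \<gamma> \<in> arrows G \<Longrightarrow> f \<gamma> = g \<gamma>"
  shows "f = g"
  using assms by (auto simp: carrier_section_group intro: extensionalityI)

lemma comm_group_section_group: "comm_group (section_group G \<O>)"
proof (rule comm_groupI)
  let ?S = "section_group G \<O>"
  show closed: "f \<otimes>\<^bsub>?S\<^esub> g \<in> carrier ?S" if "f \<in> carrier ?S" "g \<in> carrier ?S" for f g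
    using that by (auto simp: carrier_section_group section_group_mult add_closed rng_in_units)
  show one: "\<one>\<^bsub>?S\<^esub> \<in> carrier ?S"
    by (auto simp: carrier_section_group section_group_one zero_closed rng_in_units)
  show "f \<otimes>\<^bsub>?S\<^esub> g \<otimes>\<^bsub>?S\<^esub> h = f \<otimes>\<^bsub>?S\<^esub> (g \<otimes>\<^bsub>?S\<^esub> h)"
    if "f \<in> carrier ?S" "g \<in> carrier ?S" "h \<in> carrier ?S" for f g h
    using that eadd_assoc[OF rng_in_units section_stalk section_stalk section_stalk]
    by (auto simp: section_group_mult intro!: restrict_ext)
  show "f \<otimes>\<^bsub>?S\<^esub> g = g \<otimes>\<^bsub>?S\<^esub> f" if "f \<in> carrier ?S" "g \<in> carrier ?S" for f g
    using that eadd_comm[OF rng_in_units section_stalk section_stalk]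
    by (auto simp: section_group_mult intro!: restrict_ext)
  show "\<one>\<^bsub>?S\<^esub> \<otimes>\<^bsub>?S\<^esub> f = f" if "f \<in> carrier ?S" for f
    using closed[OF one that] that
    by (rule section_eqI) (use that in \<open>simp add: section_group_mult section_group_one add_zero rng_in_units section_stalk\<close>)
  show "\<exists>g\<in>carrier ?S. g \<otimes>\<^bsub>?S\<^esub> f = \<one>\<^bsub>?S\<^esub>" if "f \<in> carrier ?S" for f
  proof
    show "(\<lambda>\<gamma>\<in>arrows G. eneg (f \<gamma>)) \<in> carrier ?S"
      using that by (simp add: carrier_section_group neg_closed rng_in_units)
    show "(\<lambda>\<gamma>\<in>arrows G. eneg (f \<gamma>)) \<otimes>\<^bsub>?S\<^esub> f = \<one>\<^bsub>?S\<^esub>"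
      using that add_neg(2)[OF rng_in_units section_stalk]
      by (auto simp: section_group_mult section_group_one intro!: restrict_ext)
  qed
qed

sublocale S: comm_group "section_group G \<O>"
  by (rule comm_group_section_group)

lemma section_group_inv:
  assumes "f \<in> carrier (section_group G \<O>)"
  shows "inv\<^bsub>section_group G \<O>\<^esub> f = (\<lambda>\<gamma>\<in>arrows G. eneg (f \<gamma>))"
proof (rule S.inv_equality)
  show "(\<lambda>\<gamma>\<in>arrows G. eneg (f \<gamma>)) \<otimes>\<^bsub>section_group G \<O>\<^esub> f = \<one>\<^bsub>section_group G \<O>\<^esub>"
    using assms add_neg(2)[OF rng_in_units section_stalk]
    by (auto simp: section_group_mult section_group_one intro!: restrict_ext)
  show "(\<lambda>\<gamma>\<in>arrows G. eneg (f \<gamma>)) \<in> carrier (section_group G \<O>)"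
    using assms by (simp add: carrier_section_group neg_closed rng_in_units)
qed (fact assms)

lemma gamma_c_generators_subset: "gamma_c_generators G \<O> \<subseteq> carrier (section_group G \<O>)"
  by (auto simp: gamma_c_generators_def)

text \<open>A formula \<open>h\<close> for the values on \<open>U\<close> suffices. Continuity is
  required on \<open>U\<close> only, so \<open>f\<close> may jump to zero at the boundary of
  \<open>U\<close>.\<close>

lemma gamma_c_generatorsI:
  assumes "f \<in> carrier (section_group G \<O>)" "compact_open_bisection G U"
    "continuous_map (subtopology (gtop G) U) (etop \<O>) h" "\<And>\<gamma>. \<gamma> \<in> U \<Longrightarrow> f \<gamma> = h \<gamma>"
    "\<And>\<gamma>. \<lbrakk>\<gamma> \<in> arrows G; \<gamma> \<notin> U\<rbrakk> \<Longrightarrow> f \<gamma> = ezero \<O> (rng G \<gamma>)"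
  shows "f \<in> gamma_c_generators G \<O>"
proof -
  have "continuous_map (subtopology (gtop G) U) (etop \<O>) f"
    using assms(3) by (rule continuous_map_eq) (simp add: assms(4))
  then show ?thesis using assms by (auto simp: gamma_c_generators_def)
qed

text \<open>Closure of the generators under negation, a consequence of the continuity of
  \<open>eneg\<close>, is what allows every element of the ring to be written as a sum of
  generators.\<close>

lemma gamma_c_generators_inv:
  assumes "f \<in> gamma_c_generators G \<O>"
  shows "inv\<^bsub>section_group G \<O>\<^esub> f \<in> gamma_c_generators G \<O>"
proof -
  have f: "f \<in> carrier (section_group G \<O>)" using assms gamma_c_generators_subset by blast
  obtain U where U: "compact_open_bisection G U" "continuous_map (subtopology (gtop G) U) (etop \<O>) f"
      "\<And>\<gamma>. \<lbrakk>\<gamma> \<in> arrows G; \<gamma> \<notin> U\<rbrakk> \<Longrightarrow> f \<gamma> = ezero \<O> (rng G \<gamma>)"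
    using assms by (auto simp: gamma_c_generators_def)
  have sub: "U \<subseteq> arrows G" using U compact_open_bisection_subset by blast
  show ?thesis
  proof (rule gamma_c_generatorsI[OF S.inv_closed[OF f] U(1)])
    show "continuous_map (subtopology (gtop G) U) (etop \<O>) (\<lambda>\<gamma>. eneg (f \<gamma>))"
      using continuous_map_compose[OF U(2) continuous_eneg] by (simp add: o_def)
    show "(inv\<^bsub>section_group G \<O>\<^esub> f) \<gamma> = eneg (f \<gamma>)" if "\<gamma> \<in> U" for \<gamma>
      using section_group_inv[OF f] that sub by auto
    show "(inv\<^bsub>section_group G \<O>\<^esub> f) \<gamma> = ezero \<O> (rng G \<gamma>)" if "\<gamma> \<in> arrows G" "\<gamma> \<notin> U" for \<gamma>
      using section_group_inv[OF f] that U(3) neg_unique[of "rng G \<gamma>" "ezero \<O> (rng G \<gamma>)" "ezero \<O> (rng G \<gamma>)"]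
      by (simp add: rng_in_units zero_closed add_zero)
  qed
qed

abbreviation gamma_c_sums :: "nat \<Rightarrow> ('g \<Rightarrow> 'e) set" where
  "gamma_c_sums \<equiv> sums_of_length (section_group G \<O>) (gamma_c_generators G \<O>)"

lemma carrier_gamma_c: "carrier (gamma_c G \<O>) = (\<Union>n. gamma_c_sums n)"
  using S.generate_eq_sums_of_length[OF gamma_c_generators_subset gamma_c_generators_inv]
  by (simp add: gamma_c_def)

lemma gamma_c_sums_subset: "gamma_c_sums n \<subseteq> carrier (section_group G \<O>)"
  using S.sums_of_length_closed gamma_c_generators_subset by blast

lemma gamma_c_generators_in_carrier: "f \<in> gamma_c_generators G \<O> \<Longrightarrow> f \<in> carrier (gamma_c G \<O>)"
  by (simp add: gamma_c_def generate.incl)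

lemma gamma_c_subset: "carrier (gamma_c G \<O>) \<subseteq> carrier (section_group G \<O>)"
  using carrier_gamma_c gamma_c_sums_subset by auto

text \<open>An additive map that preserves generators acts on each term of a sum separately.
  Translations and multiplications by continuous coefficients are of this kind.\<close>

lemma gamma_c_sums_map:
  assumes "\<And>f. f \<in> gamma_c_generators G \<O> \<Longrightarrow> \<Phi> f \<in> gamma_c_generators G \<O>"
    and "\<Phi> \<in> hom (section_group G \<O>) (section_group G \<O>)"
    and "f \<in> gamma_c_sums n"
  shows "\<Phi> f \<in> gamma_c_sums n"
  using assms(3)
proof (induction n arbitrary: f)
  case 0
  then show ?case using hom_one[OF assms(2)] S.is_group by simp
next
  case (Suc n)
  then obtain g h where gh: "f = g \<otimes>\<^bsub>section_group G \<O>\<^esub> h" "g \<in> gamma_c_generators G \<O>" "h \<in> gamma_c_sums n"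
    by auto
  then have "\<Phi> f = \<Phi> g \<otimes>\<^bsub>section_group G \<O>\<^esub> \<Phi> h"
    using hom_mult[OF assms(2)] gamma_c_generators_subset gamma_c_sums_subset by blast
  then show ?case using gh assms(1) Suc.IH by auto
qed

text \<open>If every term vanished at \<open>\<gamma>\<close>, so would the sum. Some term therefore
  survives there, and commutativity moves it to the front.\<close>

lemma gamma_c_sums_extract:
  assumes "f \<in> gamma_c_sums n" "\<gamma> \<in> arrows G" "f \<gamma> \<noteq> ezero \<O> (rng G \<gamma>)"
  shows "\<exists>m g h. n = Suc m \<and> g \<in> gamma_c_generators G \<O> \<and> g \<gamma> \<noteq> ezero \<O> (rng G \<gamma>) \<and>
    h \<in> gamma_c_sums m \<and> f = g \<otimes>\<^bsub>section_group G \<O>\<^esub> h"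
  using assms(1,3)
proof (induction n arbitrary: f)
  case 0
  then show ?case using assms(2) by (simp add: section_group_one)
next
  case (Suc n)
  then obtain g h where gh: "f = g \<otimes>\<^bsub>section_group G \<O>\<^esub> h" "g \<in> gamma_c_generators G \<O>" "h \<in> gamma_c_sums n"
    by auto
  show ?case
  proof (cases "g \<gamma> = ezero \<O> (rng G \<gamma>)")
    case False
    then show ?thesis using gh by blast
  next
    case True
    have g: "g \<in> carrier (section_group G \<O>)" using gh gamma_c_generators_subset by blast
    have "h \<in> carrier (section_group G \<O>)" using gh gamma_c_sums_subset by blast
    then have "f \<gamma> = h \<gamma>"
      using gh True assms(2) add_zero(2)[OF rng_in_units section_stalk] by (simp add: section_group_mult)
    then obtain m g' h' where h: "n = Suc m" "g' \<in> gamma_c_generators G \<O>" "g' \<gamma> \<noteq> ezero \<O> (rng G \<gamma>)"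
        "h' \<in> gamma_c_sums m" "h = g' \<otimes>\<^bsub>section_group G \<O>\<^esub> h'"
      using Suc.IH[OF gh(3)] Suc.prems(2) by auto
    have "g' \<in> carrier (section_group G \<O>)" "h' \<in> carrier (section_group G \<O>)"
      using h gamma_c_generators_subset gamma_c_sums_subset by blast+
    \<comment> \<open>The surviving term sits in the tail \<open>h\<close>. It changes places with
      \<open>g\<close>, which joins the tail, so the length of the tail is kept.\<close>
    then have "f = g' \<otimes>\<^bsub>section_group G \<O>\<^esub> (g \<otimes>\<^bsub>section_group G \<O>\<^esub> h')"
      using gh(1) h(5) g S.m_lcomm by simp
    moreover have "g \<otimes>\<^bsub>section_group G \<O>\<^esub> h' \<in> gamma_c_sums n"
      using h(1,4) gh(2) by auto
    ultimately show ?thesis using h by blast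
  qed
qed

section \<open>Convolution\<close>

text \<open>The coefficient \<open>c \<gamma>\<close> is meant to lie in the stalk over the range of
  \<open>\<gamma>\<close>, where the value of \<open>f\<close> lives. Both products with a section
  over the units take this form.\<close>

definition scale_section :: "('g \<Rightarrow> 'e) \<Rightarrow> ('g \<Rightarrow> 'e) \<Rightarrow> 'g \<Rightarrow> 'e" where
  "scale_section c f = (\<lambda>\<gamma>\<in>arrows G. emult \<O> (f \<gamma>) (c \<gamma>))"

text \<open>This is right convolution by the indicator of \<open>V^{-1}\<close>, given pointwise:
  additivity and the effect on generators are visible from the formula, while the convolution form
  shows that a kernel is preserved.\<close>

definition translate :: "'g set \<Rightarrow> ('g \<Rightarrow> 'e) \<Rightarrow> 'g \<Rightarrow> 'e" where
  "translate V f = (\<lambda>\<gamma>\<in>arrows G.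
    if src G \<gamma> \<in> rng G ` V then f (right_shift V \<gamma>) else ezero \<O> (rng G \<gamma>))"

definition indicator_section :: "'g set \<Rightarrow> 'g \<Rightarrow> 'e" where
  "indicator_section V = (\<lambda>\<gamma>\<in>arrows G. if \<gamma> \<in> V then eone \<O> (rng G \<gamma>) else ezero \<O> (rng G \<gamma>))"

lemma scale_section_in_section_group:
  assumes "\<And>\<gamma>. \<gamma> \<in> arrows G \<Longrightarrow> c \<gamma> \<in> carrier (stalk \<O> (rng G \<gamma>))"
    and "f \<in> carrier (section_group G \<O>)"
  shows "scale_section c f \<in> carrier (section_group G \<O>)"
  using assms by (simp add: carrier_section_group scale_section_def emult_closed rng_in_units)

lemma scale_section_hom:
  assumes "\<And>\<gamma>. \<gamma> \<in> arrows G \<Longrightarrow> c \<gamma> \<in> carrier (stalk \<O> (rng G \<gamma>))"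
  shows "scale_section c \<in> hom (section_group G \<O>) (section_group G \<O>)"
proof (rule homI)
  show "scale_section c f \<in> carrier (section_group G \<O>)" if "f \<in> carrier (section_group G \<O>)" for f
    using scale_section_in_section_group assms that by blast
  show "scale_section c (f \<otimes>\<^bsub>section_group G \<O>\<^esub> g) = scale_section c f \<otimes>\<^bsub>section_group G \<O>\<^esub> scale_section c g"
    if "f \<in> carrier (section_group G \<O>)" "g \<in> carrier (section_group G \<O>)" for f g
    unfolding scale_section_def section_group_mult
  proof (rule restrict_ext)
    fix \<gamma> assume \<gamma>: "\<gamma> \<in> arrows G"
    show "emult \<O> (restrict (\<lambda>\<gamma>. eadd \<O> (f \<gamma>) (g \<gamma>)) (arrows G) \<gamma>) (c \<gamma>) =
      eadd \<O> (restrict (\<lambda>\<gamma>. emult \<O> (f \<gamma>) (c \<gamma>)) (arrows G) \<gamma>)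
        (restrict (\<lambda>\<gamma>. emult \<O> (g \<gamma>) (c \<gamma>)) (arrows G) \<gamma>)"
      using \<gamma> emult_add(2)[OF rng_in_units[OF \<gamma>] assms[OF \<gamma>] section_stalk[OF that(1) \<gamma>] section_stalk[OF that(2) \<gamma>]]
      by simp
  qed
qed

text \<open>The same bisection supports the product: off \<open>U\<close> one factor is zero, and on
  \<open>U\<close> the product is continuous because \<open>c\<close> is continuous on all
  arrows.\<close>

lemma scale_section_generators:
  assumes "\<And>\<gamma>. \<gamma> \<in> arrows G \<Longrightarrow> c \<gamma> \<in> carrier (stalk \<O> (rng G \<gamma>))"
    and "continuous_map (gtop G) (etop \<O>) c"
    and "f \<in> gamma_c_generators G \<O>"
  shows "scale_section c f \<in> gamma_c_generators G \<O>"
proof -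
  have f: "f \<in> carrier (section_group G \<O>)" using assms(3) gamma_c_generators_subset by blast
  obtain U where U: "compact_open_bisection G U" "continuous_map (subtopology (gtop G) U) (etop \<O>) f"
      "\<And>\<gamma>. \<lbrakk>\<gamma> \<in> arrows G; \<gamma> \<notin> U\<rbrakk> \<Longrightarrow> f \<gamma> = ezero \<O> (rng G \<gamma>)"
    using assms(3) by (auto simp: gamma_c_generators_def)
  have sub: "U \<subseteq> arrows G" using U compact_open_bisection_subset by blast
  show ?thesis
  proof (rule gamma_c_generatorsI[OF scale_section_in_section_group[OF assms(1) f] U(1)])
    show "continuous_map (subtopology (gtop G) U) (etop \<O>) (\<lambda>\<gamma>. emult \<O> (f \<gamma>) (c \<gamma>))"
    proof (rule continuous_emult_compose[OF U(2) continuous_map_from_subtopology[OF assms(2)]])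
      fix z assume "z \<in> topspace (subtopology (gtop G) U)"
      then have "z \<in> arrows G" by (simp add: topspace_gtop)
      then show "proj \<O> (f z) = proj \<O> (c z)"
        using assms(1) section_stalk[OF f] by (simp add: carrier_stalk)
    qed
    show "scale_section c f \<gamma> = emult \<O> (f \<gamma>) (c \<gamma>)" if "\<gamma> \<in> U" for \<gamma>
      using that sub by (auto simp: scale_section_def)
    show "scale_section c f \<gamma> = ezero \<O> (rng G \<gamma>)" if "\<gamma> \<in> arrows G" "\<gamma> \<notin> U" for \<gamma>
      using that by (simp add: scale_section_def U(3) emult_zero rng_in_units assms(1))
  qed
qed

lemma scale_section_sums:
  assumes "\<And>\<gamma>. \<gamma> \<in> arrows G \<Longrightarrow> c \<gamma> \<in> carrier (stalk \<O> (rng G \<gamma>))"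
    and "continuous_map (gtop G) (etop \<O>) c"
    and "f \<in> gamma_c_sums n"
  shows "scale_section c f \<in> gamma_c_sums n"
  using scale_section_generators[OF assms(1,2)] scale_section_hom[OF assms(1)] assms(3)
  by (rule gamma_c_sums_map)

lemma translate_in_section_group:
  assumes "V \<subseteq> arrows G" "f \<in> carrier (section_group G \<O>)"
  shows "translate V f \<in> carrier (section_group G \<O>)"
proof -
  have "f (right_shift V \<gamma>) \<in> carrier (stalk \<O> (rng G \<gamma>))"
    if "\<gamma> \<in> arrows G" "src G \<gamma> \<in> rng G ` V" for \<gamma>
    using section_stalk[OF assms(2) right_shift(4)[OF assms(1) that]] right_shift(5)[OF assms(1) that]
    by simp
  then show ?thesis by (simp add: carrier_section_group translate_def zero_closed rng_in_units)
qed

lemma translate_hom: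
  assumes "V \<subseteq> arrows G"
  shows "translate V \<in> hom (section_group G \<O>) (section_group G \<O>)"
proof (rule homI)
  show "translate V f \<in> carrier (section_group G \<O>)" if "f \<in> carrier (section_group G \<O>)" for f
    using translate_in_section_group assms that by blast
  show "translate V (f \<otimes>\<^bsub>section_group G \<O>\<^esub> g) = translate V f \<otimes>\<^bsub>section_group G \<O>\<^esub> translate V g"
    if "f \<in> carrier (section_group G \<O>)" "g \<in> carrier (section_group G \<O>)" for f g
    unfolding translate_def section_group_mult
    by (rule restrict_ext) (simp add: right_shift(4)[OF assms] add_zero zero_closed rng_in_units)
qed

text \<open>The translate is supported where the shift lands in \<open>U\<close>, and this product
  of bisections is again a compact open bisection.\<close>

lemma translate_generators:
  assumes "compact_open_bisection G V" "f \<in> gamma_c_generators G \<O>"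
  shows "translate V f \<in> gamma_c_generators G \<O>"
proof -
  have f: "f \<in> carrier (section_group G \<O>)" using assms(2) gamma_c_generators_subset by blast
  obtain U where U: "compact_open_bisection G U" "continuous_map (subtopology (gtop G) U) (etop \<O>) f"
      "\<And>\<gamma>. \<lbrakk>\<gamma> \<in> arrows G; \<gamma> \<notin> U\<rbrakk> \<Longrightarrow> f \<gamma> = ezero \<O> (rng G \<gamma>)"
    using assms(2) by (auto simp: gamma_c_generators_def)
  have V: "V \<subseteq> arrows G" "openin (gtop G) V" "inj_on (rng G) V"
    using assms(1) compact_open_bisection_subset by (auto simp: compact_open_bisection_def)
  let ?D = "{\<gamma> \<in> arrows G. src G \<gamma> \<in> rng G ` V}"
  let ?W = "{\<gamma> \<in> arrows G. src G \<gamma> \<in> rng G ` V \<and> right_shift V \<gamma> \<in> U}"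
  show ?thesis
  proof (rule gamma_c_generatorsI[OF translate_in_section_group[OF V(1) f]
        compact_open_bisection_right_shift[OF U(1) assms(1)]])
    have "?W \<subseteq> ?D" by blast
    then have "continuous_map (subtopology (gtop G) ?W) (gtop G) (right_shift V)"
      by (rule continuous_map_from_subtopology_mono[OF continuous_right_shift[OF V(2,3)]])
    then have "continuous_map (subtopology (gtop G) ?W) (subtopology (gtop G) U) (right_shift V)"
      by (auto simp: continuous_map_in_subtopology)
    from continuous_map_compose[OF this U(2)]
    show "continuous_map (subtopology (gtop G) ?W) (etop \<O>) (\<lambda>\<gamma>. f (right_shift V \<gamma>))"
      by (simp add: o_def)
    show "translate V f \<gamma> = f (right_shift V \<gamma>)" if "\<gamma> \<in> ?W" for \<gamma>
      using that by (simp add: translate_def)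
    show "translate V f \<gamma> = ezero \<O> (rng G \<gamma>)" if "\<gamma> \<in> arrows G" "\<gamma> \<notin> ?W" for \<gamma>
    proof (cases "src G \<gamma> \<in> rng G ` V")
      case True
      then have "right_shift V \<gamma> \<notin> U" using that by simp
      then show ?thesis
        using U(3)[OF right_shift(4)[OF V(1) that(1) True]] right_shift(5)[OF V(1) that(1) True] True that(1)
        by (simp add: translate_def)
    qed (use that in \<open>simp add: translate_def\<close>)
  qed
qed

lemma indicator_section_generator:
  assumes "compact_open_bisection G V"
  shows "indicator_section V \<in> gamma_c_generators G \<O>"
proof (rule gamma_c_generatorsI[OF _ assms])
  have V: "V \<subseteq> arrows G" using assms compact_open_bisection_subset by blast
  show "indicator_section V \<in> carrier (section_group G \<O>)"
    by (simp add: carrier_section_group indicator_section_def one_closed zero_closed rng_in_units)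
  show "continuous_map (subtopology (gtop G) V) (etop \<O>) (\<lambda>\<gamma>. eone \<O> (rng G \<gamma>))"
    using continuous_map_from_subtopology[OF continuous_map_compose[OF continuous_rng continuous_one]]
    by (simp add: o_def)
  show "indicator_section V \<gamma> = eone \<O> (rng G \<gamma>)" if "\<gamma> \<in> V" for \<gamma>
    using that V by (auto simp: indicator_section_def)
qed (simp add: indicator_section_def)

section \<open>Convolutions with at most one nonzero term\<close>

lemma convolution_term_closed:
  assumes "f \<in> carrier (section_group G \<O>)" "g \<in> carrier (section_group G \<O>)" "composable G \<beta> \<rho>"
  shows "emult \<O> (f \<beta>) (act \<O> \<beta> (g \<rho>)) \<in> carrier (stalk \<O> (rng G \<beta>))"
proof -
  have a: "\<beta> \<in> arrows G" "\<rho> \<in> arrows G" "src G \<beta> = rng G \<rho>" using assms(3) by (auto simp: composable_def)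
  show ?thesis
    using emult_closed[OF rng_in_units[OF a(1)] section_stalk[OF assms(1) a(1)] act_closed[OF a(1)]]
      section_stalk[OF assms(2) a(2)] a(3) by simp
qed

lemma convolution_term_zero:
  assumes "f \<in> carrier (section_group G \<O>)" "g \<in> carrier (section_group G \<O>)" "composable G \<beta> \<rho>"
    and "f \<beta> = ezero \<O> (rng G \<beta>) \<or> g \<rho> = ezero \<O> (rng G \<rho>)"
  shows "emult \<O> (f \<beta>) (act \<O> \<beta> (g \<rho>)) = ezero \<O> (rng G \<beta>)"
proof -
  have a: "\<beta> \<in> arrows G" "\<rho> \<in> arrows G" "src G \<beta> = rng G \<rho>" using assms(3) by (auto simp: composable_def)
  have "act \<O> \<beta> (g \<rho>) \<in> carrier (stalk \<O> (rng G \<beta>))"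
    using act_closed[OF a(1)] section_stalk[OF assms(2) a(2)] a(3) by simp
  then show ?thesis
    using assms(4) emult_zero[OF rng_in_units[OF a(1)]] section_stalk[OF assms(1) a(1)]
      act_zero[OF a(1)] a(3) by metis
qed

text \<open>Every factorisation contributes zero, and zero terms are left out of the index set, so
  the sum is empty.\<close>

lemma convolution_eq_zero:
  assumes "f \<in> carrier (section_group G \<O>)" "g \<in> carrier (section_group G \<O>)" "\<gamma> \<in> arrows G"
    and "\<And>\<beta> \<rho>. \<lbrakk>composable G \<beta> \<rho>; gmult G \<beta> \<rho> = \<gamma>\<rbrakk>
      \<Longrightarrow> f \<beta> = ezero \<O> (rng G \<beta>) \<or> g \<rho> = ezero \<O> (rng G \<rho>)"
  shows "convolution G \<O> f g \<gamma> = ezero \<O> (rng G \<gamma>)"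
proof -
  interpret R: cring "stalk \<O> (rng G \<gamma>)" using stalk_cring rng_in_units assms(3) by blast
  have *: "{(\<beta>, \<rho>). composable G \<beta> \<rho> \<and> gmult G \<beta> \<rho> = \<gamma> \<and>
        emult \<O> (f \<beta>) (act \<O> \<beta> (g \<rho>)) \<noteq> ezero \<O> (rng G \<gamma>)} = {}"
    using convolution_term_zero[OF assms(1,2)] assms(4) rng_mult by fastforce
  then show ?thesis
    by (simp only: convolution_def restrict_apply' assms(3) * R.finsum_empty stalk_simps)
qed

text \<open>Uniqueness is demanded only of factorisations at which both factors are nonzero; all
  others contribute zero because the action and the multiplication preserve zero.\<close>

lemma convolution_eq_single:
  assumes "f \<in> carrier (section_group G \<O>)" "g \<in> carrier (section_group G \<O>)"
    and "composable G \<beta>\<^sub>0 \<rho>\<^sub>0" "gmult G \<beta>\<^sub>0 \<rho>\<^sub>0 = \<gamma>"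
    and "\<And>\<beta> \<rho>. \<lbrakk>composable G \<beta> \<rho>; gmult G \<beta> \<rho> = \<gamma>; f \<beta> \<noteq> ezero \<O> (rng G \<beta>);
      g \<rho> \<noteq> ezero \<O> (rng G \<rho>)\<rbrakk> \<Longrightarrow> \<beta> = \<beta>\<^sub>0 \<and> \<rho> = \<rho>\<^sub>0"
  shows "convolution G \<O> f g \<gamma> = emult \<O> (f \<beta>\<^sub>0) (act \<O> \<beta>\<^sub>0 (g \<rho>\<^sub>0))"
proof -
  have \<gamma>: "\<gamma> \<in> arrows G" "rng G \<gamma> = rng G \<beta>\<^sub>0" using assms(3,4) mult_closed rng_mult by auto
  interpret R: cring "stalk \<O> (rng G \<gamma>)" using stalk_cring rng_in_units \<gamma> by blast
  let ?t = "\<lambda>\<beta> \<rho>. emult \<O> (f \<beta>) (act \<O> \<beta> (g \<rho>))"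
  let ?I = "{(\<beta>, \<rho>). composable G \<beta> \<rho> \<and> gmult G \<beta> \<rho> = \<gamma> \<and> ?t \<beta> \<rho> \<noteq> ezero \<O> (rng G \<gamma>)}"
  have sub: "?I \<subseteq> {(\<beta>\<^sub>0, \<rho>\<^sub>0)}"
    using convolution_term_zero[OF assms(1,2)] assms(5) rng_mult by fastforce
  have t0: "?t \<beta>\<^sub>0 \<rho>\<^sub>0 \<in> carrier (stalk \<O> (rng G \<gamma>))"
    using convolution_term_closed[OF assms(1-3)] \<gamma>(2) by simp
  have "finsum (stalk \<O> (rng G \<gamma>)) (\<lambda>(\<beta>, \<rho>). ?t \<beta> \<rho>) ?I = ?t \<beta>\<^sub>0 \<rho>\<^sub>0"
  \<comment> \<open>The distinguished term may itself be zero, even for nonzero factors, since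
    stalks can have zero divisors. It is then missing from the index set, and the sum is
    empty.\<close>
  proof (cases "?t \<beta>\<^sub>0 \<rho>\<^sub>0 = ezero \<O> (rng G \<gamma>)")
    case True
    then have I: "?I = {}" using sub by auto
    show ?thesis unfolding I using True R.finsum_empty by simp
  next
    case False
    then have I: "?I = {(\<beta>\<^sub>0, \<rho>\<^sub>0)}" using sub assms(3,4) by blast
    show ?thesis
      unfolding I
      using R.finsum_insert[of "{}" "(\<beta>\<^sub>0, \<rho>\<^sub>0)" "\<lambda>(\<beta>, \<rho>). ?t \<beta> \<rho>"] t0 R.finsum_empty R.r_zero[OF t0]
      by simp
  qed
  then show ?thesis using \<gamma>(1) by (simp add: convolution_def)
qed

lemma convolution_extensional: "convolution G \<O> f g \<in> extensional (arrows G)"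
  by (simp add: convolution_def)

text \<open>A factorisation of \<open>\<gamma>\<close> with right factor \<open>v^{-1}\<close>,
  \<open>v\<close> in \<open>V\<close>, forces \<open>v\<close> to have range
  \<open>src G \<gamma>\<close> and the left factor to be \<open>\<gamma> v\<close>; injectivity of
  \<open>rng G\<close> on \<open>V\<close> leaves at most one. The action preserves the value 1, so
  only the value of \<open>f\<close> at \<open>\<gamma> v\<close> remains.\<close>

lemma convolution_indicator:
  assumes V: "compact_open_bisection G V" and f: "f \<in> carrier (section_group G \<O>)"
  shows "convolution G \<O> f (indicator_section (ginv G ` V)) = translate V f"
proof (rule extensionalityI[OF convolution_extensional])
  let ?\<chi> = "indicator_section (ginv G ` V)"
  have Vs: "V \<subseteq> arrows G" "inj_on (rng G) V"
    using V compact_open_bisection_subset by (auto simp: compact_open_bisection_def)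
  have \<chi>: "?\<chi> \<in> carrier (section_group G \<O>)"
    using indicator_section_generator[OF compact_open_bisection_inv[OF V]] gamma_c_generators_subset by blast
  have \<chi>0: "?\<chi> \<rho> = ezero \<O> (rng G \<rho>)" if "\<rho> \<in> arrows G" "\<rho> \<notin> ginv G ` V" for \<rho>
    using that by (simp add: indicator_section_def)
  show "translate V f \<in> extensional (arrows G)" by (simp add: translate_def)
  have fact: "v \<in> arrows G \<and> rng G v = src G \<gamma> \<and> gmult G \<gamma> v = \<beta>"
    if "composable G \<beta> (ginv G v)" "gmult G \<beta> (ginv G v) = \<gamma>" "v \<in> V" for \<beta> v \<gamma>
  proof -
    have v: "v \<in> arrows G" using that Vs by blast
    have "src G \<gamma> = rng G v" using src_mult[OF that(1)] that(2) src_inv[OF v] by simp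
    moreover have "gmult G \<gamma> v = \<beta>" using mult_inv_cancel[OF that(1)] that(2) inv_inv[OF v] by simp
    ultimately show ?thesis using v by simp
  qed
  fix \<gamma> assume \<gamma>: "\<gamma> \<in> arrows G"
  show "convolution G \<O> f ?\<chi> \<gamma> = translate V f \<gamma>"
  proof (cases "src G \<gamma> \<in> rng G ` V")
    case True
    define v where "v = inv_into V (rng G) (src G \<gamma>)"
    define b where "b = right_shift V \<gamma>"
    have r: "v \<in> V" "rng G v = src G \<gamma>" "b \<in> arrows G" "rng G b = rng G \<gamma>" "src G b = src G v"
        "gmult G b (ginv G v) = \<gamma>"
      using right_shift[OF Vs(1) \<gamma> True] by (simp_all add: v_def b_def)
    have v: "v \<in> arrows G" "ginv G v \<in> arrows G" using r(1) Vs(1) inv_closed by auto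
    have c: "composable G b (ginv G v)" using r v by (simp add: composable_def rng_inv)
    have "convolution G \<O> f ?\<chi> \<gamma> = emult \<O> (f b) (act \<O> b (?\<chi> (ginv G v)))"
    proof (rule convolution_eq_single[OF f \<chi> c r(6)])
      fix \<beta> \<rho> assume *: "composable G \<beta> \<rho>" "gmult G \<beta> \<rho> = \<gamma>" "?\<chi> \<rho> \<noteq> ezero \<O> (rng G \<rho>)"
      then obtain w where w: "w \<in> V" "\<rho> = ginv G w" using \<chi>0 by (force simp: composable_def)
      have w': "rng G w = src G \<gamma>" "gmult G \<gamma> w = \<beta>" using fact * w by auto
      then have "w = v" using inj_onD[OF Vs(2) _ w(1) r(1)] r(2) by simp
      moreover have "gmult G \<gamma> v = b" by (simp add: b_def v_def right_shift_def)
      ultimately show "\<beta> = b \<and> \<rho> = ginv G v" using w w'(2) by simp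
    qed
    also have "?\<chi> (ginv G v) = eone \<O> (src G b)"
      using v r(1,5) by (simp add: indicator_section_def rng_inv)
    also have "emult \<O> (f b) (act \<O> b (eone \<O> (src G b))) = f b"
      using act_one[OF r(3)] emult_one[OF rng_in_units[OF r(3)] section_stalk[OF f r(3)]] by simp
    also have "f b = translate V f \<gamma>" using \<gamma> True by (simp add: translate_def b_def)
    finally show ?thesis .
  next
    case False
    have "convolution G \<O> f ?\<chi> \<gamma> = ezero \<O> (rng G \<gamma>)"
    proof (rule convolution_eq_zero[OF f \<chi> \<gamma>])
      fix \<beta> \<rho> assume *: "composable G \<beta> \<rho>" "gmult G \<beta> \<rho> = \<gamma>"
      have "\<rho> \<notin> ginv G ` V"
      proof
        assume "\<rho> \<in> ginv G ` V"
        then obtain w where "w \<in> V" "\<rho> = ginv G w" by blast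
        then show False using fact[of \<beta> w \<gamma>] * False by (metis image_eqI)
      qed
      then show "f \<beta> = ezero \<O> (rng G \<beta>) \<or> ?\<chi> \<rho> = ezero \<O> (rng G \<rho>)"
        using \<chi>0 *(1) by (simp add: composable_def)
    qed
    then show ?thesis using \<gamma> False by (simp add: translate_def)
  qed
qed

section \<open>Sections over the units and their commutators\<close>

lemma compact_sections_stalk:
  "\<lbrakk>s \<in> compact_sections G \<O>; x \<in> units G\<rbrakk> \<Longrightarrow> s x \<in> carrier (stalk \<O> x)"
  using continuous_map_funspace[of "unit_top G" "etop \<O>" s]
  by (auto simp: compact_sections_def carrier_stalk topspace_unit_top)

lemma extend_by_zero_in_section_group:
  assumes "s \<in> compact_sections G \<O>"
  shows "extend_by_zero G \<O> s \<in> carrier (section_group G \<O>)"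
  using compact_sections_stalk[OF assms]
  by (simp add: carrier_section_group extend_by_zero_def zero_closed rng_in_units rng_unit)

text \<open>The compact support is covered by finitely many compact open sets of units. Their union
  is a compact open bisection because source and range are the identity on units.\<close>

lemma extend_by_zero_generator:
  assumes s: "s \<in> compact_sections G \<O>"
  shows "extend_by_zero G \<O> s \<in> gamma_c_generators G \<O>"
proof -
  let ?S = "{x \<in> units G. s x \<noteq> ezero \<O> x}"
  let ?K = "unit_top G closure_of ?S"
  let ?B = "{B. openin (unit_top G) B \<and> compactin (unit_top G) B}"
  have K: "compactin (unit_top G) ?K" using s by (simp add: compact_sections_def)
  have "?K \<subseteq> \<Union>?B"
  proof
    fix x assume "x \<in> ?K"
    then have "x \<in> units G" using closure_of_subset_topspace topspace_unit_top by fastforce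
    then show "x \<in> \<Union>?B"
      using units_basis[of "topspace (unit_top G)" x] openin_topspace[of "unit_top G"] topspace_unit_top
      by blast
  qed
  then obtain F where F: "finite F" "F \<subseteq> ?B" "?K \<subseteq> \<Union>F"
    using compactinD[OF K, of ?B] by auto
  define U where "U = \<Union>F"
  have U: "openin (unit_top G) U" "compactin (unit_top G) U"
    using F by (auto simp: U_def intro!: openin_Union compactin_Union)
  have Uu: "U \<subseteq> units G" using U(1) openin_unit_top by blast
  have cob: "compact_open_bisection G U"
  proof (rule compact_open_bisectionI)
    show "openin (gtop G) U" using U(1) openin_unit_top by blast
    show "compactin (gtop G) U" using U(2) compactin_unit_top by blast
    show "inj_on (src G) U" "inj_on (rng G) U"
      using Uu by (auto simp: inj_on_def src_unit rng_unit subset_iff)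
  qed
  show ?thesis
  proof (rule gamma_c_generatorsI[OF extend_by_zero_in_section_group[OF s] cob])
    have "continuous_map (unit_top G) (etop \<O>) s" using s by (simp add: compact_sections_def)
    then show "continuous_map (subtopology (gtop G) U) (etop \<O>) s"
      unfolding unit_top_def by (rule continuous_map_from_subtopology_mono[OF _ Uu])
    show "extend_by_zero G \<O> s \<gamma> = s \<gamma>" if "\<gamma> \<in> U" for \<gamma>
      using that Uu unit_arrow by (auto simp: extend_by_zero_def)
    show "extend_by_zero G \<O> s \<gamma> = ezero \<O> (rng G \<gamma>)" if "\<gamma> \<in> arrows G" "\<gamma> \<notin> U" for \<gamma>
    proof (cases "\<gamma> \<in> units G")
      case True
      have "?S \<subseteq> ?K" by (rule closure_of_subset) (auto simp: topspace_unit_top)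
      then have "s \<gamma> = ezero \<O> \<gamma>" using that True F(3) by (auto simp: U_def)
      then show ?thesis using that True by (simp add: extend_by_zero_def rng_unit)
    qed (use that in \<open>simp add: extend_by_zero_def\<close>)
  qed
qed

text \<open>A left factor with nonzero value is a unit, hence the range of \<open>\<gamma>\<close>,
  and units act trivially. Commutativity of the stalk then moves the coefficient to the right, so
  that left and right products have a common form.\<close>

lemma convolution_extend_left:
  assumes s: "s \<in> compact_sections G \<O>" and f: "f \<in> carrier (section_group G \<O>)"
  shows "convolution G \<O> (extend_by_zero G \<O> s) f = scale_section (\<lambda>\<gamma>. s (rng G \<gamma>)) f"
proof (rule extensionalityI[OF convolution_extensional])
  show "scale_section (\<lambda>\<gamma>. s (rng G \<gamma>)) f \<in> extensional (arrows G)" by (simp add: scale_section_def)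
  let ?a = "extend_by_zero G \<O> s"
  fix \<gamma> assume \<gamma>: "\<gamma> \<in> arrows G"
  have r: "rng G \<gamma> \<in> units G" using rng_in_units[OF \<gamma>] .
  have "convolution G \<O> ?a f \<gamma> = emult \<O> (?a (rng G \<gamma>)) (act \<O> (rng G \<gamma>) (f \<gamma>))"
  proof (rule convolution_eq_single[OF extend_by_zero_in_section_group[OF s] f])
    show "composable G (rng G \<gamma>) \<gamma>" using \<gamma> r by (simp add: composable_def unit_arrow src_unit)
    show "gmult G (rng G \<gamma>) \<gamma> = \<gamma>" using rng_mult_left[OF \<gamma>] .
    fix \<beta> \<rho> assume *: "composable G \<beta> \<rho>" "gmult G \<beta> \<rho> = \<gamma>" "?a \<beta> \<noteq> ezero \<O> (rng G \<beta>)"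
    then have b: "\<beta> \<in> units G" "\<rho> \<in> arrows G" "src G \<beta> = rng G \<rho>"
      by (auto simp: composable_def extend_by_zero_def split: if_splits)
    then have "\<beta> = rng G \<rho>" by (simp add: src_unit)
    then show "\<beta> = rng G \<gamma> \<and> \<rho> = \<gamma>" using rng_mult_left[OF b(2)] *(2) by simp
  qed
  also have "\<dots> = emult \<O> (s (rng G \<gamma>)) (f \<gamma>)"
    using r act_unit_arrow[OF r section_stalk[OF f \<gamma>]] by (simp add: extend_by_zero_def unit_arrow)
  also have "\<dots> = emult \<O> (f \<gamma>) (s (rng G \<gamma>))"
    using emult_comm[OF r compact_sections_stalk[OF s r] section_stalk[OF f \<gamma>]] .
  finally show "convolution G \<O> ?a f \<gamma> = scale_section (\<lambda>\<gamma>. s (rng G \<gamma>)) f \<gamma>"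
    using \<gamma> by (simp add: scale_section_def)
qed

text \<open>A right factor with nonzero value is the unit at the source of \<open>\<gamma>\<close>,
  and the action carries its value into the stalk over the range.\<close>

lemma convolution_extend_right:
  assumes s: "s \<in> compact_sections G \<O>" and f: "f \<in> carrier (section_group G \<O>)"
  shows "convolution G \<O> f (extend_by_zero G \<O> s) = scale_section (\<lambda>\<gamma>. act \<O> \<gamma> (s (src G \<gamma>))) f"
proof (rule extensionalityI[OF convolution_extensional])
  show "scale_section (\<lambda>\<gamma>. act \<O> \<gamma> (s (src G \<gamma>))) f \<in> extensional (arrows G)" by (simp add: scale_section_def)
  let ?a = "extend_by_zero G \<O> s"
  fix \<gamma> assume \<gamma>: "\<gamma> \<in> arrows G"
  have r: "src G \<gamma> \<in> units G" using src_in_units[OF \<gamma>] .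
  have "convolution G \<O> f ?a \<gamma> = emult \<O> (f \<gamma>) (act \<O> \<gamma> (?a (src G \<gamma>)))"
  proof (rule convolution_eq_single[OF f extend_by_zero_in_section_group[OF s]])
    show "composable G \<gamma> (src G \<gamma>)" using \<gamma> r by (simp add: composable_def unit_arrow rng_unit)
    show "gmult G \<gamma> (src G \<gamma>) = \<gamma>" using mult_src[OF \<gamma>] .
    fix \<beta> \<rho> assume *: "composable G \<beta> \<rho>" "gmult G \<beta> \<rho> = \<gamma>" "?a \<rho> \<noteq> ezero \<O> (rng G \<rho>)"
    then have b: "\<rho> \<in> units G" "\<beta> \<in> arrows G" "src G \<beta> = rng G \<rho>"
      by (auto simp: composable_def extend_by_zero_def split: if_splits)
    then have "\<rho> = src G \<beta>" by (simp add: rng_unit)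
    then show "\<beta> = \<gamma> \<and> \<rho> = src G \<gamma>" using mult_src[OF b(2)] *(2) by simp
  qed
  also have "\<dots> = scale_section (\<lambda>\<gamma>. act \<O> \<gamma> (s (src G \<gamma>))) f \<gamma>"
    using r \<gamma> by (simp add: extend_by_zero_def unit_arrow scale_section_def)
  finally show "convolution G \<O> f ?a \<gamma> = scale_section (\<lambda>\<gamma>. act \<O> \<gamma> (s (src G \<gamma>))) f \<gamma>" .
qed

lemma compact_section_rng:
  assumes s: "s \<in> compact_sections G \<O>"
  shows "\<gamma> \<in> arrows G \<Longrightarrow> s (rng G \<gamma>) \<in> carrier (stalk \<O> (rng G \<gamma>))"
    and "continuous_map (gtop G) (etop \<O>) (\<lambda>\<gamma>. s (rng G \<gamma>))"
proof -
  show "\<gamma> \<in> arrows G \<Longrightarrow> s (rng G \<gamma>) \<in> carrier (stalk \<O> (rng G \<gamma>))"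
    using compact_sections_stalk[OF s] rng_in_units by blast
  have "continuous_map (unit_top G) (etop \<O>) s" using s by (simp add: compact_sections_def)
  from continuous_map_compose[OF continuous_rng this]
  show "continuous_map (gtop G) (etop \<O>) (\<lambda>\<gamma>. s (rng G \<gamma>))" by (simp add: o_def)
qed

lemma compact_section_act:
  assumes s: "s \<in> compact_sections G \<O>"
  shows "\<gamma> \<in> arrows G \<Longrightarrow> act \<O> \<gamma> (s (src G \<gamma>)) \<in> carrier (stalk \<O> (rng G \<gamma>))"
    and "continuous_map (gtop G) (etop \<O>) (\<lambda>\<gamma>. act \<O> \<gamma> (s (src G \<gamma>)))"
proof -
  have c: "s (src G \<gamma>) \<in> carrier (stalk \<O> (src G \<gamma>))" if "\<gamma> \<in> arrows G" for \<gamma>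
    using compact_sections_stalk[OF s] src_in_units that by blast
  then show "\<gamma> \<in> arrows G \<Longrightarrow> act \<O> \<gamma> (s (src G \<gamma>)) \<in> carrier (stalk \<O> (rng G \<gamma>))"
    using act_closed by blast
  have "continuous_map (unit_top G) (etop \<O>) s" using s by (simp add: compact_sections_def)
  from continuous_map_compose[OF continuous_src this]
  have "continuous_map (gtop G) (etop \<O>) (\<lambda>\<gamma>. s (src G \<gamma>))" by (simp add: o_def)
  then show "continuous_map (gtop G) (etop \<O>) (\<lambda>\<gamma>. act \<O> \<gamma> (s (src G \<gamma>)))"
    using c by (intro continuous_act_compose) (simp_all add: topspace_gtop carrier_stalk)
qed

definition commutator_coeff :: "('g \<Rightarrow> 'e) \<Rightarrow> 'g \<Rightarrow> 'e" where
  "commutator_coeff s \<gamma> = eadd \<O> (act \<O> \<gamma> (s (src G \<gamma>))) (eneg (s (rng G \<gamma>)))"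

text \<open>The coefficient vanishes at a unit because a unit acts trivially and equals its source
  and range. Continuity holds on the whole arrow space, so generators with any support can be
  multiplied by it.\<close>

lemma commutator_coeff:
  assumes s: "s \<in> compact_sections G \<O>"
  shows commutator_coeff_stalk: "\<gamma> \<in> arrows G \<Longrightarrow> commutator_coeff s \<gamma> \<in> carrier (stalk \<O> (rng G \<gamma>))"
    and commutator_coeff_continuous: "continuous_map (gtop G) (etop \<O>) (commutator_coeff s)"
    and commutator_coeff_unit: "x \<in> units G \<Longrightarrow> commutator_coeff s x = ezero \<O> x"
    and commutator_coeff_add: "\<gamma> \<in> arrows G
      \<Longrightarrow> eadd \<O> (commutator_coeff s \<gamma>) (s (rng G \<gamma>)) = act \<O> \<gamma> (s (src G \<gamma>))"
proof -
  note c = compact_section_rng[OF s] compact_section_act[OF s]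
  have n: "eneg (s (rng G \<gamma>)) \<in> carrier (stalk \<O> (rng G \<gamma>))" if "\<gamma> \<in> arrows G" for \<gamma>
    using neg_closed[OF rng_in_units[OF that] c(1)[OF that]] .
  show "\<gamma> \<in> arrows G \<Longrightarrow> commutator_coeff s \<gamma> \<in> carrier (stalk \<O> (rng G \<gamma>))"
    using add_closed[OF rng_in_units c(3) n] by (simp add: commutator_coeff_def)
  have "continuous_map (gtop G) (etop \<O>) (\<lambda>\<gamma>. eneg (s (rng G \<gamma>)))"
    using continuous_map_compose[OF c(2) continuous_eneg] by (simp add: o_def)
  then show "continuous_map (gtop G) (etop \<O>) (commutator_coeff s)"
    unfolding commutator_coeff_def[abs_def] using c(3) n
    by (intro continuous_eadd_compose c(4)) (simp_all add: topspace_gtop carrier_stalk)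
  show "commutator_coeff s x = ezero \<O> x" if "x \<in> units G"
    using that act_unit_arrow[OF that] compact_sections_stalk[OF s that] add_neg(1)[OF that]
    by (simp add: commutator_coeff_def src_unit rng_unit)
  show "eadd \<O> (commutator_coeff s \<gamma>) (s (rng G \<gamma>)) = act \<O> \<gamma> (s (src G \<gamma>))" if \<gamma>: "\<gamma> \<in> arrows G"
    using eadd_assoc[OF rng_in_units[OF \<gamma>] c(3)[OF \<gamma>] n[OF \<gamma>] c(1)[OF \<gamma>]]
      add_neg(2)[OF rng_in_units[OF \<gamma>] c(1)[OF \<gamma>]] add_zero(1)[OF rng_in_units[OF \<gamma>] c(3)[OF \<gamma>]]
    by (simp add: commutator_coeff_def)
qed

text \<open>The commutator is expressed by a sum instead of a difference, so that a homomorphism can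
  be applied using only that it preserves sums and products. The equation is distributivity applied
  to the two convolution formulas.\<close>

lemma commutator_eq:
  assumes s: "s \<in> compact_sections G \<O>" and f: "f \<in> carrier (section_group G \<O>)"
  shows "scale_section (commutator_coeff s) f \<otimes>\<^bsub>section_group G \<O>\<^esub> convolution G \<O> (extend_by_zero G \<O> s) f
    = convolution G \<O> f (extend_by_zero G \<O> s)"
  unfolding convolution_extend_left[OF s f] convolution_extend_right[OF s f]
proof -
  let ?c = "commutator_coeff s" and ?l = "\<lambda>\<gamma>. s (rng G \<gamma>)" and ?r = "\<lambda>\<gamma>. act \<O> \<gamma> (s (src G \<gamma>))"
  note st = commutator_coeff_stalk[OF s] compact_section_rng(1)[OF s] compact_section_act(1)[OF s]
  show "scale_section ?c f \<otimes>\<^bsub>section_group G \<O>\<^esub> scale_section ?l f = scale_section ?r f"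
  proof (rule section_eqI)
    show "scale_section ?c f \<otimes>\<^bsub>section_group G \<O>\<^esub> scale_section ?l f \<in> carrier (section_group G \<O>)"
      using st(1,2) f by (intro S.m_closed scale_section_in_section_group)
    show "scale_section ?r f \<in> carrier (section_group G \<O>)" using st(3) f by (rule scale_section_in_section_group)
    fix \<gamma> assume \<gamma>: "\<gamma> \<in> arrows G"
    show "(scale_section ?c f \<otimes>\<^bsub>section_group G \<O>\<^esub> scale_section ?l f) \<gamma> = scale_section ?r f \<gamma>"
      using \<gamma> emult_add(1)[OF rng_in_units[OF \<gamma>] section_stalk[OF f \<gamma>] st(1)[OF \<gamma>] st(2)[OF \<gamma>]]
        commutator_coeff_add[OF s \<gamma>]
      by (simp add: section_group_mult scale_section_def)
  qed
qed

lemma gamma_c_carrierI: "f \<in> gamma_c_sums n \<Longrightarrow> f \<in> carrier (gamma_c G \<O>)"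
  by (auto simp: carrier_gamma_c)

lemma gamma_c_add_closed:
  "\<lbrakk>f \<in> carrier (gamma_c G \<O>); g \<in> carrier (gamma_c G \<O>)\<rbrakk>
    \<Longrightarrow> f \<otimes>\<^bsub>section_group G \<O>\<^esub> g \<in> carrier (gamma_c G \<O>)"
  by (simp add: gamma_c_def generate.eng)

lemma gamma_c_inv_closed:
  assumes "f \<in> carrier (gamma_c G \<O>)"
  shows "inv\<^bsub>section_group G \<O>\<^esub> f \<in> carrier (gamma_c G \<O>)"
  using assms S.generate_m_inv_closed[OF gamma_c_generators_subset] by (simp add: gamma_c_def)

text \<open>The neutral element of \<open>section_group\<close> is the zero of the ring. Its
  membership in the centralizer lets injectivity there exclude a nonzero kernel element.\<close>

lemma one_in_centralizer:
  "\<one>\<^bsub>section_group G \<O>\<^esub> \<in> centralizer_in (gamma_c G \<O>) (gamma_c_units G \<O>)"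
proof -
  have "convolution G \<O> \<one>\<^bsub>section_group G \<O>\<^esub> (extend_by_zero G \<O> s)
      = convolution G \<O> (extend_by_zero G \<O> s) \<one>\<^bsub>section_group G \<O>\<^esub>"
    if s: "s \<in> compact_sections G \<O>" for s
    unfolding convolution_extend_left[OF s S.one_closed] convolution_extend_right[OF s S.one_closed]
    using hom_one[OF scale_section_hom[OF compact_section_rng(1)[OF s]]]
      hom_one[OF scale_section_hom[OF compact_section_act(1)[OF s]]] S.is_group by simp
  then show ?thesis
    by (auto simp: centralizer_in_def gamma_c_units_def gamma_c_def generate.one)
qed

section \<open>The kernel of a ring homomorphism\<close>

context
  fixes A :: "('a, 'm) ring_scheme" and \<pi> :: "('g \<Rightarrow> 'e) \<Rightarrow> 'a"
  assumes A: "nonunital_ring A" and hom: "\<pi> \<in> nonunital_ring_hom (gamma_c G \<O>) A"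
begin

interpretation A: nonunital_ring A by (rule A)

lemma pi_hom:
  shows pi_closed: "f \<in> carrier (gamma_c G \<O>) \<Longrightarrow> \<pi> f \<in> carrier A"
    and pi_conv: "\<lbrakk>f \<in> carrier (gamma_c G \<O>); g \<in> carrier (gamma_c G \<O>)\<rbrakk>
      \<Longrightarrow> \<pi> (convolution G \<O> f g) = \<pi> f \<otimes>\<^bsub>A\<^esub> \<pi> g"
    and pi_add: "\<lbrakk>f \<in> carrier (gamma_c G \<O>); g \<in> carrier (gamma_c G \<O>)\<rbrakk>
      \<Longrightarrow> \<pi> (f \<otimes>\<^bsub>section_group G \<O>\<^esub> g) = \<pi> f \<oplus>\<^bsub>A\<^esub> \<pi> g"
  using hom by (auto simp: nonunital_ring_hom_def hom_def gamma_c_def)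

lemma pi_zero: "\<pi> \<one>\<^bsub>section_group G \<O>\<^esub> = \<zero>\<^bsub>A\<^esub>"
proof -
  have 1: "\<one>\<^bsub>section_group G \<O>\<^esub> \<in> carrier (gamma_c G \<O>)" by (simp add: gamma_c_def generate.one)
  then have "\<pi> \<one>\<^bsub>section_group G \<O>\<^esub> \<oplus>\<^bsub>A\<^esub> \<pi> \<one>\<^bsub>section_group G \<O>\<^esub> = \<pi> \<one>\<^bsub>section_group G \<O>\<^esub>"
    using pi_add[OF 1 1] by simp
  then show ?thesis using A.add.l_cancel_one pi_closed[OF 1] by simp
qed

lemma kernel_meets_centralizer:
  assumes f: "f \<in> carrier (gamma_c G \<O>)" "\<pi> f = \<zero>\<^bsub>A\<^esub>" "f \<noteq> \<one>\<^bsub>section_group G \<O>\<^esub>"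
  obtains h where "h \<in> centralizer_in (gamma_c G \<O>) (gamma_c_units G \<O>)" "\<pi> h = \<zero>\<^bsub>A\<^esub>"
    "h \<noteq> \<one>\<^bsub>section_group G \<O>\<^esub>"
proof -
  let ?S = "section_group G \<O>"
  define P where "P n \<longleftrightarrow> (\<exists>f\<in>gamma_c_sums n. \<pi> f = \<zero>\<^bsub>A\<^esub> \<and> f \<noteq> \<one>\<^bsub>?S\<^esub>)" for n
  have "\<exists>n. P n" using f by (auto simp: P_def carrier_gamma_c)
  then obtain n where n: "P n" "\<And>m. m < n \<Longrightarrow> \<not> P m"
    using exists_least_iff[of P] by auto
  obtain k where k: "k \<in> gamma_c_sums n" "\<pi> k = \<zero>\<^bsub>A\<^esub>" "k \<noteq> \<one>\<^bsub>?S\<^esub>" using n(1) by (auto simp: P_def)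
  have kS: "k \<in> carrier ?S" and kc: "k \<in> carrier (gamma_c G \<O>)"
    using k(1) gamma_c_sums_subset gamma_c_carrierI by blast+
  obtain \<gamma> where \<gamma>: "\<gamma> \<in> arrows G" "k \<gamma> \<noteq> ezero \<O> (rng G \<gamma>)"
    using section_eqI[OF kS S.one_closed] k(3) by (auto simp: section_group_one)
  \<comment> \<open>The extracted term \<open>g\<close> is nonzero at \<open>\<gamma>\<close>, so
    its bisection \<open>U\<close> contains \<open>\<gamma>\<close>; this is what keeps the
    translate by \<open>U\<close> from vanishing.\<close>
  obtain m g r where m: "n = Suc m" and g: "g \<in> gamma_c_generators G \<O>" "g \<gamma> \<noteq> ezero \<O> (rng G \<gamma>)"
    and r: "r \<in> gamma_c_sums m" and kgr: "k = g \<otimes>\<^bsub>?S\<^esub> r"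
    using gamma_c_sums_extract[OF k(1) \<gamma>] by blast
  obtain U where U: "compact_open_bisection G U"
      "\<And>\<gamma>. \<lbrakk>\<gamma> \<in> arrows G; \<gamma> \<notin> U\<rbrakk> \<Longrightarrow> g \<gamma> = ezero \<O> (rng G \<gamma>)"
    using g(1) by (auto simp: gamma_c_generators_def)
  have Us: "U \<subseteq> arrows G" "inj_on (src G) U" "inj_on (rng G) U"
    using U(1) compact_open_bisection_subset by (auto simp: compact_open_bisection_def)
  have \<gamma>U: "\<gamma> \<in> U" using U(2) \<gamma>(1) g(2) by blast
  have gS: "g \<in> carrier ?S" and rS: "r \<in> carrier ?S"
    using g r gamma_c_generators_subset gamma_c_sums_subset by blast+
  note th = translate_hom[OF Us(1)]
  define h where "h = translate U k"
  define g' where "g' = translate U g"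
  define r' where "r' = translate U r"
  have h_eq: "h = g' \<otimes>\<^bsub>?S\<^esub> r'"
    using hom_mult[OF th gS rS] by (simp add: h_def g'_def r'_def kgr)
  have g'S: "g' \<in> carrier ?S" using hom_in_carrier[OF th gS] by (simp add: g'_def)
  have r': "r' \<in> gamma_c_sums m"
    unfolding r'_def by (rule gamma_c_sums_map[OF translate_generators[OF U(1)] th r])
  then have r'S: "r' \<in> carrier ?S" using gamma_c_sums_subset by blast
  have hS: "h \<in> carrier ?S" using hom_in_carrier[OF th kS] by (simp add: h_def)
  have hc: "h \<in> carrier (gamma_c G \<O>)"
    unfolding h_def using gamma_c_sums_map[OF translate_generators[OF U(1)] th k(1)] gamma_c_carrierI by blast
  have "\<pi> h = \<zero>\<^bsub>A\<^esub>"
  proof -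
    let ?\<chi> = "indicator_section (ginv G ` U)"
    have \<chi>: "?\<chi> \<in> carrier (gamma_c G \<O>)"
      using indicator_section_generator[OF compact_open_bisection_inv[OF U(1)]] gamma_c_generators_in_carrier by blast
    have "\<pi> h = \<pi> k \<otimes>\<^bsub>A\<^esub> \<pi> ?\<chi>"
      using pi_conv[OF kc \<chi>] convolution_indicator[OF U(1) kS] by (simp add: h_def)
    then show ?thesis using k(2) A.l_null pi_closed[OF \<chi>] by simp
  qed
  have "h \<noteq> \<one>\<^bsub>?S\<^esub>"
  proof -
    \<comment> \<open>The arrow of \<open>U\<close> with range \<open>?x\<close> is
      \<open>\<gamma>\<close> itself, so the shift of \<open>?x\<close> is \<open>\<gamma>\<close>,
      and \<open>h\<close> takes at \<open>?x\<close> the nonzero value of \<open>k\<close> at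
      \<open>\<gamma>\<close>.\<close>
    let ?x = "rng G \<gamma>"
    have x: "?x \<in> units G" "?x \<in> arrows G" using \<gamma>(1) rng_in_units unit_arrow by auto
    have "right_shift U ?x = \<gamma>"
      using x inv_into_f_f[OF Us(3) \<gamma>U] rng_mult_left[OF \<gamma>(1)] by (simp add: right_shift_def src_unit)
    then have "h ?x = k \<gamma>" using x \<gamma>U by (simp add: h_def translate_def src_unit)
    then have "h ?x \<noteq> \<one>\<^bsub>?S\<^esub> ?x" using \<gamma>(2) x by (simp add: section_group_one rng_unit)
    then show ?thesis by auto
  qed
  \<comment> \<open>If the shift of \<open>\<delta>\<close> lies in \<open>U\<close>, it has the
    same source as the arrow \<open>v\<close> of \<open>U\<close> used for the shift and so equals
    \<open>v\<close>; hence \<open>\<delta> = v v^{-1}\<close> is a unit. For other arrows in the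
    domain of the shift, \<open>g\<close> vanishes at the shifted arrow.\<close>
  have g'_units: "g' \<delta> = ezero \<O> (rng G \<delta>)" if \<delta>: "\<delta> \<in> arrows G" "\<delta> \<notin> units G" for \<delta>
  proof (cases "src G \<delta> \<in> rng G ` U")
    case True
    define v where "v = inv_into U (rng G) (src G \<delta>)"
    have rs: "v \<in> U" "right_shift U \<delta> \<in> arrows G" "rng G (right_shift U \<delta>) = rng G \<delta>"
        "src G (right_shift U \<delta>) = src G v" "gmult G (right_shift U \<delta>) (ginv G v) = \<delta>"
      using right_shift[OF Us(1) \<delta>(1) True] by (simp_all add: v_def)
    have "right_shift U \<delta> \<notin> U"
    proof
      assume "right_shift U \<delta> \<in> U"
      then have "right_shift U \<delta> = v" using inj_onD[OF Us(2) rs(4)] rs(1) by blast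
      then have "\<delta> = rng G v" using rs(5) by (simp add: rng_def)
      then show False using \<delta>(2) rs(1) Us(1) rng_in_units by blast
    qed
    then show ?thesis using True \<delta>(1) U(2)[OF rs(2)] rs(3) by (simp add: g'_def translate_def)
  qed (use \<delta>(1) in \<open>simp add: g'_def translate_def\<close>)
  have comm: "convolution G \<O> h a = convolution G \<O> a h" if a_units: "a \<in> gamma_c_units G \<O>" for a
  proof -
    obtain s where s: "s \<in> compact_sections G \<O>" "a = extend_by_zero G \<O> s"
      using a_units by (auto simp: gamma_c_units_def)
    let ?c = "commutator_coeff s"
    have a: "a \<in> carrier (gamma_c G \<O>)"
      using s extend_by_zero_generator gamma_c_generators_in_carrier by blast
    note ch = scale_section_hom[OF commutator_coeff_stalk[OF s(1)]]
    \<comment> \<open>At units the coefficient is zero; at all other arrows \<open>g'\<close> is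
      zero.\<close>
    have "scale_section ?c g' = \<one>\<^bsub>?S\<^esub>"
    proof (rule section_eqI[OF hom_in_carrier[OF ch g'S] S.one_closed])
      fix \<delta> assume \<delta>: "\<delta> \<in> arrows G"
      show "scale_section ?c g' \<delta> = \<one>\<^bsub>?S\<^esub> \<delta>"
      proof (cases "\<delta> \<in> units G")
        case True
        then show ?thesis
          using \<delta> commutator_coeff_unit[OF s(1) True] emult_zero(1)[OF rng_in_units[OF \<delta>] section_stalk[OF g'S \<delta>]]
          by (simp add: scale_section_def section_group_one rng_unit)
      next
        case False
        then show ?thesis
          using \<delta> g'_units emult_zero(2)[OF rng_in_units[OF \<delta>] commutator_coeff_stalk[OF s(1) \<delta>]]
          by (simp add: scale_section_def section_group_one)
      qed
    qed
    then have "scale_section ?c h = scale_section ?c r'"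
      using hom_mult[OF ch g'S r'S] hom_in_carrier[OF ch r'S] by (simp add: h_eq)
    then have sm: "scale_section ?c h \<in> gamma_c_sums m"
      using scale_section_sums[OF commutator_coeff_stalk[OF s(1)] commutator_coeff_continuous[OF s(1)] r']
      by simp
    then have sc: "scale_section ?c h \<in> carrier (gamma_c G \<O>)" by (rule gamma_c_carrierI)
    have eq: "scale_section ?c h \<otimes>\<^bsub>?S\<^esub> convolution G \<O> a h = convolution G \<O> h a"
      using commutator_eq[OF s(1) hS] s(2) by simp
    \<comment> \<open>The product of \<open>a\<close> and \<open>h\<close> is a pointwise multiple
      of \<open>h\<close> by a continuous coefficient, hence again a sum of generators. This puts it
      into the ring, as additivity of \<open>\<pi>\<close> requires.\<close>
    obtain l where "h \<in> gamma_c_sums l" using hc by (auto simp: carrier_gamma_c)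
    note scale_section_sums[OF compact_section_rng[OF s(1)] this]
    then have "convolution G \<O> a h \<in> gamma_c_sums l"
      by (simp add: s(2) convolution_extend_left[OF s(1) hS])
    then have ah: "convolution G \<O> a h \<in> carrier (gamma_c G \<O>)" by (rule gamma_c_carrierI)
    \<comment> \<open>Both products in this equation contain the factor \<open>\<pi> h\<close>,
      which is zero, so the commutator lies in the kernel.\<close>
    have "\<pi> (scale_section ?c h) \<oplus>\<^bsub>A\<^esub> \<pi> a \<otimes>\<^bsub>A\<^esub> \<pi> h = \<pi> h \<otimes>\<^bsub>A\<^esub> \<pi> a"
      using pi_add[OF sc ah] pi_conv[OF a hc] pi_conv[OF hc a] eq by simp
    then have "\<pi> (scale_section ?c h) = \<zero>\<^bsub>A\<^esub>"
      using \<open>\<pi> h = \<zero>\<^bsub>A\<^esub>\<close> A.l_null A.r_null pi_closed[OF a] pi_closed[OF sc] by simp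
    \<comment> \<open>The commutator has length \<open>m\<close>, one less than \<open>n\<close>, so
      minimality forces it to be zero, and \<open>eq\<close> reduces to the commutation
      claim.\<close>
    then have "scale_section ?c h = \<one>\<^bsub>?S\<^esub>"
      using sm n(2)[of m] m by (auto simp: P_def)
    then show ?thesis using eq ah gamma_c_subset by (simp add: subset_iff)
  qed
  then have "h \<in> centralizer_in (gamma_c G \<O>) (gamma_c_units G \<O>)"
    using hc by (simp add: centralizer_in_def gamma_c_def)
  then show thesis using that \<open>\<pi> h = \<zero>\<^bsub>A\<^esub>\<close> \<open>h \<noteq> \<one>\<^bsub>?S\<^esub>\<close> by blast
qed

lemma inj_on_iff_inj_on_centralizer:
  "inj_on \<pi> (carrier (gamma_c G \<O>)) \<longleftrightarrow>
    inj_on \<pi> (centralizer_in (gamma_c G \<O>) (gamma_c_units G \<O>))"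
proof
  assume "inj_on \<pi> (carrier (gamma_c G \<O>))"
  then show "inj_on \<pi> (centralizer_in (gamma_c G \<O>) (gamma_c_units G \<O>))"
    by (rule inj_on_subset) (auto simp: centralizer_in_def)
next
  assume inj: "inj_on \<pi> (centralizer_in (gamma_c G \<O>) (gamma_c_units G \<O>))"
  show "inj_on \<pi> (carrier (gamma_c G \<O>))"
  proof (rule inj_onI)
    fix f g assume f: "f \<in> carrier (gamma_c G \<O>)" and g: "g \<in> carrier (gamma_c G \<O>)" and eq: "\<pi> f = \<pi> g"
    have S: "f \<in> carrier (section_group G \<O>)" "g \<in> carrier (section_group G \<O>)"
      using f g gamma_c_subset by blast+
    let ?d = "f \<otimes>\<^bsub>section_group G \<O>\<^esub> inv\<^bsub>section_group G \<O>\<^esub> g"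
    have d: "?d \<in> carrier (gamma_c G \<O>)" using f g gamma_c_add_closed gamma_c_inv_closed by blast
    \<comment> \<open>The image of a negative is not computed: \<open>\<pi> ?d\<close> is determined
      by the equation \<open>?d + g = f\<close> and cancellation in \<open>A\<close>.\<close>
    have dg: "?d \<otimes>\<^bsub>section_group G \<O>\<^esub> g = f" using S S.m_assoc by simp
    then have "\<pi> ?d \<oplus>\<^bsub>A\<^esub> \<pi> g = \<pi> g" using pi_add[OF d g] eq by simp
    then have "\<pi> ?d = \<zero>\<^bsub>A\<^esub>" using A.add.r_cancel_one pi_closed[OF d] pi_closed[OF g] by simp
    have "?d = \<one>\<^bsub>section_group G \<O>\<^esub>"
    proof (rule ccontr)
      assume "?d \<noteq> \<one>\<^bsub>section_group G \<O>\<^esub>"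
      then obtain h where "h \<in> centralizer_in (gamma_c G \<O>) (gamma_c_units G \<O>)"
          "\<pi> h = \<zero>\<^bsub>A\<^esub>" "h \<noteq> \<one>\<^bsub>section_group G \<O>\<^esub>"
        using kernel_meets_centralizer[OF d \<open>\<pi> ?d = \<zero>\<^bsub>A\<^esub>\<close>] by blast
      then show False using inj_onD[OF inj] pi_zero one_in_centralizer by metis
    qed
    then show "f = g" using dg S by simp
  qed
qed

end

end

theorem theorem4p16:
  fixes G :: "'g groupoid"
    and \<O> :: "('g, 'e) ring_gsheaf"
    and A :: "('a, 'm) ring_scheme"
    and \<pi> :: "('g \<Rightarrow> 'e) \<Rightarrow> 'a"
    and C :: "('g \<Rightarrow> 'e) set"
  assumes "ample_groupoid G"
    and "groupoid_sheaf_of_comm_rings G \<O>"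
    and "C = centralizer_in (gamma_c G \<O>) (gamma_c_units G \<O>)"
    and "nonunital_ring A"
    and "\<pi> \<in> nonunital_ring_hom (gamma_c G \<O>) A"
  shows "inj_on \<pi> (carrier (gamma_c G \<O>)) \<longleftrightarrow> inj_on \<pi> C"
proof -
  interpret ample_groupoid_sheaf G \<O>
    using assms(1,2) by (rule ample_groupoid_sheaf.intro)
  show ?thesis
    unfolding assms(3) by (rule inj_on_iff_inj_on_centralizer[OF assms(4,5)])
qed

end
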